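(* Let $\mathcal{B}$ be a uniform body whose material groupoid $\Omega(\mathcal{B})$ is a Lie subgroupoid of $\Pi^1(\mathcal{B},\mathcal{B})$. If $\mathcal{B}$ is homogeneous, then $\Omega(\mathcal{B})$ is integrable. Conversely, if $\Omega(\mathcal{B})$ is integrable, then $\mathcal{B}$ is locally homogeneous.
   Context: 1-jets groupoid: for a manifold $M$, $\Pi^1(M,M)$ is the set of 1-jets $j^1_{x,y}\phi$ of local diffeomorphisms $\phi$ of $M$ with $\phi(x)=y$; it is a Lie groupoid over $M$ with source $\alpha(j^1_{x,y}\phi)=x$, target $\beta(j^1_{x,y}\phi)=y$, and composition of jets $j^1_{y,z}\psi\cdot j^1_{x,y}\phi=j^1_{x,z}(\psi\circ\phi)$. Body: a three-dimensional manifold $\mathcal{B}$ which can be covered by one chart, identified with an open subset of $\mathbb{R}^3$ by a fixed embedding (reference configuration). A deformation is an embedding $\kappa:\mathcal{B}\to\mathbb{R}^3$; an infinitesimal deformation at $Y$ is its 1-jet $j^1_{Y,\kappa(Y)}\kappa$. The body is equipped with a response functional: a differentiable map $W:\Pi^1(\mathcal{B},\mathcal{B})\to V$, $V$ a real vector space, such that $W(j^1_{X,Y}\phi)=W(j^1_{X,Z}(\tau_{Z-Y}\circ\phi))$ for all $X,Y,Z\in\mathcal{B}$ and all $j^1_{X,Y}\phi$, where $\tau_v$ is translation of $\mathbb{R}^3$ by $v$. By this invariance $W$ extends to 1-jets of local diffeomorphisms from points of $\mathcal{B}$ to points of $\mathbb{R}^3$. Material isomorphism: a jet $j^1_{X,Y}\psi\in\Pi^1(\mathcal{B},\mathcal{B})$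 with $W(j^1_{Y,\kappa(Y)}\kappa\cdot j^1_{X,Y}\psi)=W(j^1_{Y,\kappa(Y)}\kappa)$ for every infinitesimal deformation $j^1_{Y,\kappa(Y)}\kappa$ at $Y$. $\Omega(\mathcal{B})\subseteq\Pi^1(\mathcal{B},\mathcal{B})$ is the subgroupoid (over $\mathcal{B}$) of all material isomorphisms. $\mathcal{B}$ is uniform if for all $X,Y\in\mathcal{B}$ there is a material isomorphism from $X$ to $Y$. Standing assumption: $\Omega(\mathcal{B})$ is a Lie subgroupoid of $\Pi^1(\mathcal{B},\mathcal{B})$; it is called the material groupoid. Homogeneity: $\mathcal{B}$ is homogeneous if there is a (global) deformation $\kappa$ such that for all $X,Y\in\mathcal{B}$ the jet $P(X,Y)=j^1_{X,Y}(\kappa^{-1}\circ\tau_{\kappa(Y)-\kappa(X)}\circ\kappa)$ belongs to $\Omega(\mathcal{B})$. $\mathcal{B}$ is locally homogeneous if it is covered by open subsets which are homogeneous (as bodies, with the restricted response functional). Integrability: let $M$ be an $n$-dimensional manifold. A reduced subgroupoid $\Pi^1_G(M,M)$ of $\Pi^1(M,M)$ is a transitive Lie subgroupoid over the same base $M$; for open $U,V\subseteq M$ put $\Pi^1_G(U,V)=\Pi^1_G(M,M)\cap(\alpha,\beta)^{-1}(U\times V)$. It is integrable if there is a Lie subgroup $G$ of $Gl(n,\mathbb{R})$ such that for all $x,y\in M$ there exist open sets $U\ni x$, $V\ni y$ and local charts $\psi_U:U\to\overline{U}\subseteq\mathbb{R}^n$, $\psi_V:V\to\overline{V}\subseteq\mathbb{R}^n$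 such that the map $$j^1_{p,q}\phi\mapsto\left(\psi_U(p),\psi_V(q),j^1_{0,0}(\tau_{-\psi_V(q)}\circ\psi_V\circ\phi\circ\psi_U^{-1}\circ\tau_{\psi_U(p)})\right)$$ is a diffeomorphism from $\Pi^1_G(U,V)$ onto $\overline{U}\times\overline{V}\times G$, where $Gl(n,\mathbb{R})$ is identified with the 1-jets at $0$ of local diffeomorphisms of $\mathbb{R}^n$ fixing $0$ and $\tau_v$ denotes translation of $\mathbb{R}^n$ by $v$. *)

theory Defs
  imports "HOL-Analysis.Analysis"
begin

section \<open>Smooth maps between open subsets of Euclidean spaces\<close>

text \<open>In finite dimension and on an open set \<open>S\<close>, \<open>Ck_on k S f\<close> says that \<open>f\<close> is of class
  \<open>C\<^sup>k\<close>: all iterated directional derivatives up to order \<open>k\<close> exist and are continuous.\<close>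

primrec Ck_on :: "nat \<Rightarrow> 'a::euclidean_space set \<Rightarrow> ('a \<Rightarrow> 'b::euclidean_space) \<Rightarrow> bool" where
  "Ck_on 0 S f \<longleftrightarrow> continuous_on S f"
| "Ck_on (Suc k) S f \<longleftrightarrow> (\<forall>x\<in>S. f differentiable (at x)) \<and>
     (\<forall>v. Ck_on k S (\<lambda>x. frechet_derivative f (at x) v))"

definition smooth_on :: "'a::euclidean_space set \<Rightarrow> ('a \<Rightarrow> 'b::euclidean_space) \<Rightarrow> bool" where
  "smooth_on S f \<longleftrightarrow> (\<forall>k. Ck_on k S f)"

text \<open>Diffeomorphisms of an open set onto an open set of the same Euclidean space.  When \<open>U\<close> is an
  open subset of an open set \<open>M\<close>, these are the local charts of \<open>M\<close> with domain \<open>U\<close>.\<close>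

definition open_diffeo :: "'a::euclidean_space set \<Rightarrow> ('a \<Rightarrow> 'a) \<Rightarrow> bool" where
  "open_diffeo U \<phi> \<longleftrightarrow> open U \<and> open (\<phi> ` U) \<and> inj_on \<phi> U \<and>
     smooth_on U \<phi> \<and> smooth_on (\<phi> ` U) (inv_into U \<phi>)"

definition transl :: "'a::euclidean_space \<Rightarrow> 'a \<Rightarrow> 'a" where
  "transl v x = x + v"


section \<open>Immersed submanifolds of Euclidean spaces\<close>

text \<open>Embedded submanifolds of dimension \<open>k\<close>, by local slice charts.\<close>

definition embedded_submanifold :: "nat \<Rightarrow> 'a::euclidean_space set \<Rightarrow> bool" where
  "embedded_submanifold k S \<longleftrightarrow>
     (\<forall>p\<in>S. \<exists>U \<phi> L. p \<in> U \<and> open_diffeo U \<phi> \<and> subspace L \<and> dim L = k \<and>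
        \<phi> ` (U \<inter> S) = \<phi> ` U \<inter> L)"

text \<open>An immersed submanifold is a subset together with a manifold structure of its own that makes
  the inclusion an injective immersion.  By the local embedding theorem for immersions, such a
  structure amounts to a second countable topology on the subset, in general finer than the
  subspace topology, every point of which has an open neighbourhood that carries the subspace
  topology and is an embedded submanifold.  The topology determines the smooth structure, so an
  immersed submanifold is represented by a topology \<open>T\<close>, with underlying set \<open>topspace T\<close>.\<close>

definition immersed_submanifold :: "nat \<Rightarrow> 'a::euclidean_space topology \<Rightarrow> bool" where
  "immersed_submanifold k T \<longleftrightarrow> second_countable T \<and>
     (\<forall>p\<in>topspace T. \<exists>P. openin T P \<and> p \<in> P \<and> subtopology T P = top_of_set P \<and>
        embedded_submanifold k P)"

text \<open>Smooth maps between immersed submanifolds: continuous for the submanifold topologies, and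
  locally (in the topology of the domain) the restriction of a smooth map of the ambient
  spaces.\<close>

definition smooth_map ::
  "'a::euclidean_space topology \<Rightarrow> 'b::euclidean_space topology \<Rightarrow> ('a \<Rightarrow> 'b) \<Rightarrow> bool" where
  "smooth_map S T f \<longleftrightarrow> continuous_map S T f \<and>
     (\<forall>p\<in>topspace S. \<exists>P O' F. openin S P \<and> p \<in> P \<and> open O' \<and> P \<subseteq> O' \<and>
        smooth_on O' F \<and> (\<forall>q\<in>P. f q = F q))"

definition diffeomorphism ::
  "'a::euclidean_space topology \<Rightarrow> 'b::euclidean_space topology \<Rightarrow> ('a \<Rightarrow> 'b) \<Rightarrow> bool" where
  "diffeomorphism S T f \<longleftrightarrow> bij_betw f (topspace S) (topspace T) \<and>
     smooth_map S T f \<and> smooth_map T S (inv_into (topspace S) f)"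

definition curve_at :: "'a::euclidean_space topology \<Rightarrow> 'a \<Rightarrow> (real \<Rightarrow> 'a) \<Rightarrow> bool" where
  "curve_at T p \<gamma> \<longleftrightarrow> (\<exists>\<epsilon>>0. smooth_map (top_of_set {-\<epsilon><..<\<epsilon>}) T \<gamma>) \<and> \<gamma> 0 = p"

definition tangent_space :: "'a::euclidean_space topology \<Rightarrow> 'a \<Rightarrow> 'a set" where
  "tangent_space T p = {vector_derivative \<gamma> (at 0) | \<gamma>. curve_at T p \<gamma>}"

text \<open>Surjectivity of the tangent map \<open>\<gamma>'(0) \<mapsto> (f \<circ> \<gamma>)'(0)\<close> at every point.\<close>

definition submersion ::
  "'a::euclidean_space topology \<Rightarrow> 'b::euclidean_space topology \<Rightarrow> ('a \<Rightarrow> 'b) \<Rightarrow> bool" where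
  "submersion S T f \<longleftrightarrow> smooth_map S T f \<and>
     (\<forall>p\<in>topspace S.
        {vector_derivative (f \<circ> \<gamma>) (at 0) | \<gamma>. curve_at S p \<gamma>} = tangent_space T (f p))"


section \<open>The groupoid of 1-jets\<close>

text \<open>A 1-jet \<open>j\<^sup>1\<^bsub>x,y\<^esub> \<phi>\<close> is given by its source \<open>x\<close>, its target \<open>y = \<phi> x\<close> and the
  Jacobian matrix of \<open>\<phi>\<close> at \<open>x\<close>: two maps have the same 1-jet at \<open>x\<close> iff these data agree.\<close>

type_synonym 'n jet = "(real, 'n) vec \<times> (real, 'n) vec \<times> ((real, 'n) vec, 'n) vec"

definition jet1 :: "(real^'n \<Rightarrow> real^'n) \<Rightarrow> real^'n \<Rightarrow> ('n::finite) jet" where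
  "jet1 \<phi> x = (x, \<phi> x, jacobian \<phi> (at x))"

definition src :: "('n::finite) jet \<Rightarrow> real^'n" where "src g = fst g"
definition tgt :: "('n::finite) jet \<Rightarrow> real^'n" where "tgt g = fst (snd g)"
definition lin :: "('n::finite) jet \<Rightarrow> real^'n^'n" where "lin g = snd (snd g)"

text \<open>Composition of jets, meaningful when \<open>src h = tgt g\<close>; on Jacobians it is the chain rule.\<close>

definition jet_comp :: "('n::finite) jet \<Rightarrow> 'n jet \<Rightarrow> 'n jet"  (infixl "\<odot>" 70) where
  "h \<odot> g = (src g, tgt h, lin h ** lin g)"

definition jet_unit :: "real^'n \<Rightarrow> ('n::finite) jet" where
  "jet_unit x = (x, x, mat 1)"

definition jet_inverse :: "('n::finite) jet \<Rightarrow> 'n jet" where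
  "jet_inverse g = (tgt g, src g, matrix_inv (lin g))"

lemma jet1_comp:
  assumes "\<phi> differentiable (at x)" "\<psi> differentiable (at (\<phi> x))"
  shows "jet1 \<psi> (\<phi> x) \<odot> jet1 \<phi> x = jet1 (\<psi> \<circ> \<phi>) x"
proof -
  have "linear (frechet_derivative \<phi> (at x))" "linear (frechet_derivative \<psi> (at (\<phi> x)))"
    using assms by (auto intro: linear_frechet_derivative)
  then show ?thesis
    using frechet_derivative_compose[OF assms]
    by (simp add: jet_comp_def jet1_def src_def tgt_def lin_def jacobian_def
        matrix_compose[unfolded o_def] o_def)
qed

definition local_diffeo_at :: "(real^'n) set \<Rightarrow> real^'n \<Rightarrow> (real^'n \<Rightarrow> real^'n) \<Rightarrow> bool" where
  "local_diffeo_at M x \<phi> \<longleftrightarrow> (\<exists>U. x \<in> U \<and> U \<subseteq> M \<and> \<phi> ` U \<subseteq> M \<and> open_diffeo U \<phi>)"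

text \<open>\<open>\<Pi>\<^sup>1(M,M)\<close> for an open set \<open>M\<close>; it is an open subset of the Euclidean space of all
  triples, which gives its manifold structure.\<close>

definition jets :: "(real^'n) set \<Rightarrow> ('n::finite) jet set" where
  "jets M = {jet1 \<phi> x | \<phi> x. local_diffeo_at M x \<phi>}"

definition subgroupoid :: "(real^'n) set \<Rightarrow> ('n::finite) jet set \<Rightarrow> bool" where
  "subgroupoid M \<Omega> \<longleftrightarrow> \<Omega> \<subseteq> jets M \<and> (\<forall>x\<in>M. jet_unit x \<in> \<Omega>) \<and>
     (\<forall>g\<in>\<Omega>. jet_inverse g \<in> \<Omega>) \<and>
     (\<forall>h\<in>\<Omega>. \<forall>g\<in>\<Omega>. src h = tgt g \<longrightarrow> h \<odot> g \<in> \<Omega>)"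

text \<open>Lie subgroupoids of \<open>\<Pi>\<^sup>1(M,M)\<close> over the same base \<open>M\<close>: subgroupoids with an immersed
  submanifold structure for which they are Lie groupoids.\<close>

definition lie_subgroupoid :: "(real^'n) set \<Rightarrow> ('n::finite) jet topology \<Rightarrow> bool" where
  "lie_subgroupoid M T \<longleftrightarrow> subgroupoid M (topspace T) \<and>
     (\<exists>k. immersed_submanifold k T) \<and>
     submersion T (top_of_set M) src \<and> submersion T (top_of_set M) tgt \<and>
     smooth_map (top_of_set M) T jet_unit \<and>
     smooth_map T T jet_inverse \<and>
     smooth_map (subtopology (prod_topology T T) {(h, g). src h = tgt g}) T (\<lambda>(h, g). h \<odot> g)"

definition reduced_subgroupoid :: "(real^'n) set \<Rightarrow> ('n::finite) jet topology \<Rightarrow> bool" where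
  "reduced_subgroupoid M T \<longleftrightarrow> lie_subgroupoid M T \<and>
     (\<forall>x\<in>M. \<forall>y\<in>M. \<exists>g\<in>topspace T. src g = x \<and> tgt g = y)"

text \<open>Lie subgroups of \<open>Gl(n,\<real>)\<close>, again with an immersed submanifold structure.\<close>

definition lie_subgroup_GL :: "(real^'n^'n) topology \<Rightarrow> bool" where
  "lie_subgroup_GL G \<longleftrightarrow> (\<forall>A\<in>topspace G. invertible A) \<and> mat 1 \<in> topspace G \<and>
     (\<exists>k. immersed_submanifold k G) \<and>
     smooth_map (prod_topology G G) G (\<lambda>(A, B). A ** B) \<and>
     smooth_map G G matrix_inv"


section \<open>Integrability\<close>

text \<open>The jet \<open>j\<^sup>1\<^bsub>0,0\<^esub>(\<tau>\<^bsub>-\<psi>\<^sub>V(q)\<^esub> \<circ> \<psi>\<^sub>V \<circ> \<phi> \<circ> \<psi>\<^sub>U\<^sup>-\<^sup>1 \<circ> \<tau>\<^bsub>\<psi>\<^sub>U(p)\<^esub>)\<close> is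
  formed from \<open>g = j\<^sup>1\<^bsub>p,q\<^esub> \<phi>\<close> by composition of jets, and identified with its Jacobian.\<close>

definition trivialization ::
  "(real^'n) set \<Rightarrow> (real^'n \<Rightarrow> real^'n) \<Rightarrow> (real^'n \<Rightarrow> real^'n) \<Rightarrow> 'n jet \<Rightarrow> ('n::finite) jet" where
  "trivialization U \<psi>U \<psi>V g =
     (\<psi>U (src g), \<psi>V (tgt g),
      lin (jet1 (transl (- \<psi>V (tgt g)) \<circ> \<psi>V) (tgt g) \<odot> g \<odot>
           jet1 (inv_into U \<psi>U \<circ> transl (\<psi>U (src g))) 0))"

definition integrable_groupoid :: "(real^'n) set \<Rightarrow> ('n::finite) jet topology \<Rightarrow> bool" where
  "integrable_groupoid M T \<longleftrightarrow> reduced_subgroupoid M T \<and>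
     (\<exists>G. lie_subgroup_GL G \<and>
       (\<forall>x\<in>M. \<forall>y\<in>M. \<exists>U V \<psi>U \<psi>V.
          x \<in> U \<and> U \<subseteq> M \<and> open_diffeo U \<psi>U \<and>
          y \<in> V \<and> V \<subseteq> M \<and> open_diffeo V \<psi>V \<and>
          diffeomorphism
            (subtopology T {g. src g \<in> U \<and> tgt g \<in> V})
            (prod_topology (top_of_set (\<psi>U ` U)) (prod_topology (top_of_set (\<psi>V ` V)) G))
            (trivialization U \<psi>U \<psi>V)))"


section \<open>Bodies, material isomorphisms, uniformity and homogeneity\<close>

text \<open>Deformations: smooth embeddings, i.e. injective immersions that are homeomorphisms onto
  their image.\<close>

definition deformation :: "(real^'n) set \<Rightarrow> (real^'n \<Rightarrow> real^'n) \<Rightarrow> bool" where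
  "deformation B \<kappa> \<longleftrightarrow> smooth_on B \<kappa> \<and>
     (\<forall>X\<in>B. inj (frechet_derivative \<kappa> (at X))) \<and>
     (\<exists>\<kappa>'. homeomorphism B (\<kappa> ` B) \<kappa> \<kappa>')"

definition body :: "(real^'n) set \<Rightarrow> (('n::finite) jet \<Rightarrow> 'v::real_normed_vector) \<Rightarrow> bool" where
  "body B W \<longleftrightarrow> open B \<and> W differentiable_on (jets B) \<and>
     (\<forall>X\<in>B. \<forall>Y\<in>B. \<forall>Z\<in>B. \<forall>\<phi>. local_diffeo_at B X \<phi> \<and> \<phi> X = Y \<longrightarrow>
        W (jet1 \<phi> X) = W (jet1 (transl (Z - Y) \<circ> \<phi>) X))"

text \<open>The extension of \<open>W\<close> to jets from points of \<open>B\<close> to arbitrary points of space: the target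
  is first translated into \<open>B\<close>.  We translate it to the source; by the invariance of \<open>W\<close> any
  other point of \<open>B\<close> gives the same value.\<close>

definition response_ext ::
  "(('n::finite) jet \<Rightarrow> 'v::real_normed_vector) \<Rightarrow> 'n jet \<Rightarrow> 'v" where
  "response_ext W g = W (jet1 (transl (src g - tgt g)) (tgt g) \<odot> g)"

definition material_isomorphism ::
  "(real^'n) set \<Rightarrow> (('n::finite) jet \<Rightarrow> 'v::real_normed_vector) \<Rightarrow> 'n jet \<Rightarrow> bool" where
  "material_isomorphism B W g \<longleftrightarrow> g \<in> jets B \<and>
     (\<forall>\<kappa>. deformation B \<kappa> \<longrightarrow>
        response_ext W (jet1 \<kappa> (tgt g) \<odot> g) = response_ext W (jet1 \<kappa> (tgt g)))"

definition material_groupoid ::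
  "(real^'n) set \<Rightarrow> (('n::finite) jet \<Rightarrow> 'v::real_normed_vector) \<Rightarrow> 'n jet set" where
  "material_groupoid B W = {g. material_isomorphism B W g}"

definition uniform ::
  "(real^'n) set \<Rightarrow> (('n::finite) jet \<Rightarrow> 'v::real_normed_vector) \<Rightarrow> bool" where
  "uniform B W \<longleftrightarrow>
     (\<forall>X\<in>B. \<forall>Y\<in>B. \<exists>g. material_isomorphism B W g \<and> src g = X \<and> tgt g = Y)"

definition homogeneous ::
  "(real^'n) set \<Rightarrow> (('n::finite) jet \<Rightarrow> 'v::real_normed_vector) \<Rightarrow> bool" where
  "homogeneous B W \<longleftrightarrow>
     (\<exists>\<kappa>. deformation B \<kappa> \<and>
       (\<forall>X\<in>B. \<forall>Y\<in>B.
          jet1 (inv_into B \<kappa> \<circ> transl (\<kappa> Y - \<kappa> X) \<circ> \<kappa>) X \<in> material_groupoid B W))"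

text \<open>The sub-body \<open>U\<close> carries the restriction of \<open>W\<close> to \<open>jets U\<close>; \<open>homogeneous U W\<close> only
  depends on that restriction.\<close>

definition locally_homogeneous ::
  "(real^'n) set \<Rightarrow> (('n::finite) jet \<Rightarrow> 'v::real_normed_vector) \<Rightarrow> bool" where
  "locally_homogeneous B W \<longleftrightarrow>
     (\<forall>X\<in>B. \<exists>U. open U \<and> X \<in> U \<and> U \<subseteq> B \<and> homogeneous U W)"

end

theory Submission
  imports Defs
begin

text \<open>A jet \<open>(X, Y, A)\<close> is a material isomorphism iff \<open>W (X, X, C A) = W (Y, Y, C)\<close> for all
  invertible \<open>C\<close>, so \<open>\<Omega>\<close> is relatively closed in the groupoid of all jets.

  If \<open>\<Omega>\<close> is integrable, take charts \<open>\<psi>\<^sub>U\<close>, \<open>\<psi>\<^sub>V\<close> around the same point.  The unit at \<open>p\<close> gives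
  \<open>D\<psi>\<^sub>V(p) D\<psi>\<^sub>U(p)\<^sup>-\<^sup>1 \<in> G\<close>; the jet from \<open>p\<close> to \<open>q\<close> with this matrix in the trivialization has the
  Jacobian \<open>D\<psi>\<^sub>V(q)\<^sup>-\<^sup>1 D\<psi>\<^sub>V(p)\<close>, so \<open>\<psi>\<^sub>V\<close> is a homogeneous configuration of \<open>U \<inter> V\<close>.

  If \<open>\<kappa>\<close> is a homogeneous configuration, then in the coordinates \<open>\<kappa>\<close> the set \<open>\<Omega>\<close> becomes the
  product \<open>\<kappa>(B) \<times> \<kappa>(B) \<times> G\<close> with a matrix group \<open>G\<close>.  What has to be shown is that the given
  submanifold structure is the product one.  By Baire's theorem some embedded chart domain of \<open>\<Omega>\<close> has
  interior points in the subspace topology, so \<open>\<Omega>\<close> is embedded there, hence everywhere by homogeneity.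
  By invariance of domain the submanifold topology is then the subspace topology.  Finally, a
  factor of an embedded product is embedded, so \<open>G\<close> is a Lie subgroup.\<close>

section \<open>Calculus of smooth maps\<close>

declare Ck_on.simps(2) [simp del]

section \<open>Closure properties of maps of class C^k\<close>

lemma Ck_on_has_derivative:
  "Ck_on (Suc k) S f \<Longrightarrow> x \<in> S \<Longrightarrow> (f has_derivative frechet_derivative f (at x)) (at x)"
  by (simp add: Ck_on.simps frechet_derivative_works)

lemma Ck_on_frechet_derivative:
  "Ck_on (Suc k) S f \<Longrightarrow> Ck_on k S (\<lambda>x. frechet_derivative f (at x) v)"
  by (simp add: Ck_on.simps)

lemma Ck_on_cong:
  assumes "open S" "\<And>x. x \<in> S \<Longrightarrow> f x = g x" "Ck_on k S f"
  shows "Ck_on k S g"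
  using assms(2,3)
proof (induction k arbitrary: f g)
  case 0
  then show ?case by (simp cong: continuous_on_cong)
next
  case (Suc k)
  have g: "(g has_derivative frechet_derivative f (at x)) (at x)" if "x \<in> S" for x
    using Ck_on_has_derivative[OF Suc.prems(2) that] assms(1) that Suc.prems(1)
    by (rule has_derivative_transform_within_open)
  have "frechet_derivative f (at x) = frechet_derivative g (at x)" if "x \<in> S" for x
    using g[OF that] by (rule frechet_derivative_at)
  then have "Ck_on k S (\<lambda>x. frechet_derivative g (at x) v)" for v
    by (intro Suc.IH[OF _ Ck_on_frechet_derivative[OF Suc.prems(2)], of v]) simp
  then show ?case
    using g by (auto simp: Ck_on.simps differentiable_def)
qed

text \<open>Derivatives are unique, so any formula \<open>f'\<close> may replace
  \<open>frechet_derivative\<close>. Most closure rules below take their inductive step in this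
  form.\<close>

lemma Ck_on_SucI:
  assumes "open S" and f': "\<And>x. x \<in> S \<Longrightarrow> (f has_derivative f' x) (at x)"
    and "\<And>v. Ck_on k S (\<lambda>x. f' x v)"
  shows "Ck_on (Suc k) S f"
proof -
  have "f' x = frechet_derivative f (at x)" if "x \<in> S" for x
    using f'[OF that] by (rule frechet_derivative_at)
  then have "Ck_on k S (\<lambda>x. frechet_derivative f (at x) v)" for v
    by (intro Ck_on_cong[OF assms(1) _ assms(3)[of v]]) simp
  then show ?thesis
    using f' by (auto simp: Ck_on.simps differentiable_def)
qed

lemma Ck_on_SucD: "Ck_on (Suc k) S f \<Longrightarrow> Ck_on k S f"
proof (induction k arbitrary: f)
  case 0
  then show ?case
    by (auto simp: Ck_on.simps intro!: continuous_at_imp_continuous_on differentiable_imp_continuous_within)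
next
  case (Suc k)
  then show ?case
    unfolding Ck_on.simps(2)[of _ _ f] by blast
qed

lemma Ck_on_imp_continuous_on: "Ck_on k S f \<Longrightarrow> continuous_on S f"
  by (induction k) (auto dest: Ck_on_SucD)

lemma Ck_on_subset: "Ck_on k S f \<Longrightarrow> S' \<subseteq> S \<Longrightarrow> Ck_on k S' f"
  by (induction k arbitrary: f) (auto simp: Ck_on.simps intro: continuous_on_subset)

lemma Ck_on_const: "Ck_on k S (\<lambda>x. c)"
  by (induction k arbitrary: c) (auto simp: Ck_on.simps)

lemma Ck_on_bounded_linear:
  assumes "bounded_linear L" "open S" shows "Ck_on k S L"
proof (cases k)
  case 0
  then show ?thesis using assms by (simp add: linear_continuous_on)
next
  case (Suc k')
  have "(L has_derivative L) (at x)" for x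
    using assms(1) by (rule bounded_linear_imp_has_derivative)
  then show ?thesis
    unfolding Suc by (intro Ck_on_SucI[OF assms(2), where f' = "\<lambda>_. L"] Ck_on_const)
qed

lemma Ck_on_add:
  assumes S: "open S" and "Ck_on k S f" "Ck_on k S g"
  shows "Ck_on k S (\<lambda>x. f x + g x)"
  using assms(2,3)
proof (induction k arbitrary: f g)
  case 0
  then show ?case by (auto intro: continuous_intros)
next
  case (Suc k)
  then show ?case
    by (intro Ck_on_SucI[OF S has_derivative_add[OF Ck_on_has_derivative Ck_on_has_derivative]]
        Suc.IH Ck_on_frechet_derivative)
qed

lemma Ck_on_sum:
  assumes "open S" "\<And>i. i \<in> I \<Longrightarrow> Ck_on k S (f i)"
  shows "Ck_on k S (\<lambda>x. \<Sum>i\<in>I. f i x)"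
  using assms(2)
  by (induction I rule: infinite_finite_induct) (auto intro: Ck_on_const Ck_on_add[OF assms(1)])

lemma Ck_on_bilinear:
  assumes "bounded_bilinear B" and S: "open S" and "Ck_on k S f" "Ck_on k S g"
  shows "Ck_on k S (\<lambda>x. B (f x) (g x))"
  using assms(3,4)
proof (induction k arbitrary: f g)
  case 0
  then show ?case
    using bounded_bilinear.continuous_on[OF assms(1)] by auto
next
  case (Suc k)
  \<comment> \<open>Each term of the product rule leaves one factor undifferentiated, so the
    induction hypothesis needs f and g themselves at level k.\<close>
  note Ck_on_SucD[OF Suc.prems(1)] Ck_on_SucD[OF Suc.prems(2)]
  with Suc show ?case
    by (intro Ck_on_SucI[OF S bounded_bilinear.FDERIV[OF assms(1) Ck_on_has_derivative Ck_on_has_derivative]]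
        Ck_on_add[OF S] Suc.IH Ck_on_frechet_derivative)
qed

lemma Ck_on_compose_linear:
  assumes "bounded_linear L" and S: "open S" and "Ck_on k S f"
  shows "Ck_on k S (\<lambda>x. L (f x))"
  using assms(3)
proof (induction k arbitrary: f)
  case 0
  then show ?case
    using assms(1) by (auto intro: bounded_linear.continuous_on)
next
  case (Suc k)
  then show ?case
    by (intro Ck_on_SucI[OF S bounded_linear.has_derivative[OF assms(1) Ck_on_has_derivative]]
        Suc.IH Ck_on_frechet_derivative)
qed

lemma linear_euclidean_representation:
  fixes f :: "'a::euclidean_space \<Rightarrow> 'b::real_vector"
  assumes "linear f"
  shows "f x = (\<Sum>b\<in>Basis. (x \<bullet> b) *\<^sub>R f b)"
proof -
  have "f x = f (\<Sum>b\<in>Basis. (x \<bullet> b) *\<^sub>R b)"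
    by (simp only: euclidean_representation)
  also have "\<dots> = (\<Sum>b\<in>Basis. (x \<bullet> b) *\<^sub>R f b)"
    by (simp only: linear_sum[OF assms] linear_scale[OF assms])
  finally show ?thesis .
qed

text \<open>In the chain rule both the point \<open>f x\<close> and the direction vary with x.
  Expanding the direction in \<open>Basis\<close> separates them into scalar coefficients times
  partial derivatives of g along f, and the induction hypothesis applies to these partial
  derivatives.\<close>

lemma Ck_on_compose:
  assumes S: "open S" and "Ck_on k S f" "Ck_on k T g" and sub: "f ` S \<subseteq> T"
  shows "Ck_on k S (\<lambda>x. g (f x))"
  using assms(2,3)
proof (induction k arbitrary: g)
  case 0
  then show ?case
    by (auto intro: continuous_on_compose2[OF _ _ sub])
next
  case (Suc k)
  let ?g' = "\<lambda>y. frechet_derivative g (at y)"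
  have g': "(g has_derivative ?g' (f x)) (at (f x))" if "x \<in> S" for x
    using that sub by (intro Ck_on_has_derivative[OF Suc.prems(2)]) auto
  have D: "((\<lambda>x. g (f x)) has_derivative
      (\<lambda>v. \<Sum>b\<in>Basis. (frechet_derivative f (at x) v \<bullet> b) *\<^sub>R ?g' (f x) b)) (at x)"
    if x: "x \<in> S" for x
    using has_derivative_compose[OF Ck_on_has_derivative[OF Suc.prems(1) x] g'[OF x]]
    by (subst (asm) linear_euclidean_representation[OF has_derivative_linear[OF g'[OF x]]])
  have "Ck_on k S (\<lambda>x. ?g' (f x) b)" for b
    using Suc.IH[OF Ck_on_SucD[OF Suc.prems(1)] Ck_on_frechet_derivative[OF Suc.prems(2)]] .
  moreover have "Ck_on k S (\<lambda>x. frechet_derivative f (at x) v \<bullet> b)" for v b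
    by (rule Ck_on_compose_linear[OF bounded_linear_inner_left S Ck_on_frechet_derivative[OF Suc.prems(1)]])
  ultimately show ?case
    by (intro Ck_on_SucI[OF S D] Ck_on_sum[OF S] Ck_on_bilinear[OF bounded_bilinear_scaleR S])
qed

lemma Ck_on_Pair:
  assumes "open S" "Ck_on k S f" "Ck_on k S g"
  shows "Ck_on k S (\<lambda>x. (f x, g x))"
proof -
  have "Ck_on k S (\<lambda>x. (f x, 0) + (0, g x))"
    by (intro Ck_on_add Ck_on_compose_linear[of "\<lambda>y. (y, 0)"] Ck_on_compose_linear[of "\<lambda>y. (0, y)"]
        assms bounded_linear_Pair bounded_linear_ident bounded_linear_zero)
  then show ?thesis by simp
qed

text \<open>A product rule for a factor c that is merely continuous at a: the term with the
  derivative of c would carry the factor \<open>s a = 0\<close>. It serves to differentiate a family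
  of inverses whose differentiability is not yet known.\<close>

lemma has_derivative_scaleR_vanishing:
  fixes s :: "'a::euclidean_space \<Rightarrow> real"
  assumes s: "(s has_derivative s') (at a)" "s a = 0" and c: "isCont c a"
  shows "((\<lambda>x. s x *\<^sub>R c x) has_derivative (\<lambda>h. s' h *\<^sub>R c a)) (at a)"
proof -
  obtain K where K: "K > 0" "\<And>h. norm (s' h) \<le> norm h * K"
    using s(1) has_derivative_bounded_linear bounded_linear.pos_bounded by blast
  let ?q = "\<lambda>x. (s x - s' (x - a)) / norm (x - a)"
  have q: "(?q \<longlongrightarrow> 0) (at a)"
    using s by (simp add: has_derivative_at_within divide_inverse mult.commute)
  have c0: "((\<lambda>x. c x - c a) \<longlongrightarrow> 0) (at a)"
    using c by (simp add: isCont_def LIM_zero)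
  \<comment> \<open>The remainder quotient is a sum of two terms: the error quotient of s times c,
    and a bounded quotient times the increment of c.\<close>
  have "((\<lambda>x. ?q x *\<^sub>R c x) \<longlongrightarrow> 0 *\<^sub>R c a) (at a)"
    using q c by (intro tendsto_scaleR) (auto simp: isCont_def)
  moreover have "((\<lambda>x. (s' (x - a) / norm (x - a)) *\<^sub>R (c x - c a)) \<longlongrightarrow> 0) (at a)"
  proof (rule tendsto_0_le[OF c0, of _ K])
    show "\<forall>\<^sub>F x in at a. norm ((s' (x - a) / norm (x - a)) *\<^sub>R (c x - c a)) \<le> norm (c x - c a) * K"
    proof (intro always_eventually allI)
      fix x
      have "\<bar>s' (x - a)\<bar> / norm (x - a) \<le> K"
        using K(1) K(2)[of "x - a"] by (cases "x = a") (auto simp: field_simps)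
      then have "\<bar>s' (x - a)\<bar> / norm (x - a) * norm (c x - c a) \<le> K * norm (c x - c a)"
        by (rule mult_right_mono) simp
      then show "norm ((s' (x - a) / norm (x - a)) *\<^sub>R (c x - c a)) \<le> norm (c x - c a) * K"
        by (simp add: mult.commute)
    qed
  qed
  ultimately have "((\<lambda>x. ?q x *\<^sub>R c x + (s' (x - a) / norm (x - a)) *\<^sub>R (c x - c a)) \<longlongrightarrow> 0) (at a)"
    using tendsto_add by fastforce
  moreover have "?q x *\<^sub>R c x + (s' (x - a) / norm (x - a)) *\<^sub>R (c x - c a)
      = (s x *\<^sub>R c x - s a *\<^sub>R c a - s' (x - a) *\<^sub>R c a) /\<^sub>R norm (x - a)" for x
    using s(2) by (simp add: algebra_simps divide_inverse diff_divide_distrib)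
  moreover have "bounded_linear (\<lambda>h. s' h *\<^sub>R c a)"
    using s(1) has_derivative_bounded_linear bounded_linear_scaleR_const by blast
  ultimately show ?thesis
    by (simp add: has_derivative_at_within)
qed

text \<open>A lower bound c for \<open>A a\<close> survives as c/2 for nearby \<open>A y\<close>,
  which bounds \<open>B y\<close> uniformly. Then
  \<open>B y v - B a v = B y (v - A y (B a v))\<close> tends to 0.\<close>

lemma inverse_family_continuous:
  fixes A B :: "'a::euclidean_space \<Rightarrow> 'b::euclidean_space \<Rightarrow> 'b"
  assumes S: "open S" and lin: "\<And>y. y \<in> S \<Longrightarrow> linear (A y)"
    and BA: "\<And>y v. y \<in> S \<Longrightarrow> B y (A y v) = v" and AB: "\<And>y v. y \<in> S \<Longrightarrow> A y (B y v) = v"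
    and cont: "\<And>v. continuous_on S (\<lambda>y. A y v)"
  shows "continuous_on S (\<lambda>y. B y v)"
proof -
  have "((\<lambda>y. B y v) \<longlongrightarrow> B a v) (at a)" if a: "a \<in> S" for a
  proof -
    have near: "\<forall>\<^sub>F y in at a. y \<in> S"
      using S a eventually_at_topological by blast
    have tend: "((\<lambda>y. A y v) \<longlongrightarrow> A a v) (at a)" for v
      using cont[of v] S a by (simp add: continuous_on_eq_continuous_at isCont_def)
    have "inj (A a)"
      using BA[OF a] by (metis injI)
    then obtain c where c: "c > 0" "\<And>u. norm u * c \<le> norm (A a u)"
      using linear_inj_bounded_below_pos[of "A a"] lin[OF a] by (metis mult.commute)
    \<comment> \<open>The sum over the basis dominates the operator norm of
      \<open>A y - A a\<close>.\<close>
    have "((\<lambda>y. \<Sum>b\<in>Basis. norm (A y b - A a b)) \<longlongrightarrow> (\<Sum>b\<in>Basis. norm (A a b - A a b))) (at a)"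
      by (intro tendsto_intros tend)
    then have "\<forall>\<^sub>F y in at a. (\<Sum>b\<in>Basis. norm (A y b - A a b)) < c / 2"
      using c(1) by (auto dest!: order_tendstoD(2)[of _ _ _ "c/2"])
    with near have B: "\<forall>\<^sub>F y in at a. \<forall>w. norm (B y w) \<le> (2 / c) * norm w"
    proof eventually_elim
      case (elim y)
      have "norm u * c \<le> 2 * norm (A y u)" for u
      proof -
        have "A y u - A a u = (\<Sum>b\<in>Basis. (u \<bullet> b) *\<^sub>R (A y b - A a b))"
          unfolding scaleR_diff_right sum_subtractf
          using lin elim a by (metis linear_euclidean_representation)
        also have "norm \<dots> \<le> (\<Sum>b\<in>Basis. norm u * norm (A y b - A a b))"
          by (rule sum_norm_le) (auto intro!: mult_right_mono Basis_le_norm)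
        also have "\<dots> \<le> norm u * (c / 2)"
          unfolding sum_distrib_left[symmetric] using elim by (intro mult_left_mono) auto
        finally have "norm (A y u - A a u) \<le> norm u * (c / 2)" .
        moreover have "norm (A a u) \<le> norm (A y u) + norm (A y u - A a u)"
          by (metis norm_minus_commute norm_triangle_sub)
        ultimately show ?thesis
          using c(2)[of u] by linarith
      qed
      then have "norm (B y w) * c \<le> 2 * norm w" for w
        using AB elim by metis
      then show ?case
        using c(1) by (simp add: field_simps)
    qed
    have "((\<lambda>y. A y (B a v) - v) \<longlongrightarrow> 0) (at a)"
      using tend[of "B a v"] AB[OF a] by (simp add: LIM_zero)
    then have "((\<lambda>y. B y v - B a v) \<longlongrightarrow> 0) (at a)"
    proof (rule tendsto_0_le[where K = "2 / c"])
      show "\<forall>\<^sub>F y in at a. norm (B y v - B a v) \<le> norm (A y (B a v) - v) * (2 / c)"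
        using near B
      proof eventually_elim
        case (elim y)
        interpret linear "A y" using lin elim by blast
        have "B y v - B a v = B y (v - A y (B a v))"
          using elim BA[of y "B y v - B a v"] AB[of y v] diff by metis
        then show ?case
          using elim by (metis mult.commute norm_minus_commute)
      qed
    qed
    then show ?thesis by (rule LIM_zero_cancel)
  qed
  then show ?thesis
    by (auto simp: continuous_on_def intro: tendsto_within_subset)
qed

text \<open>Write \<open>B y v = B a v - B y (A y (B a v) - v)\<close>. The coordinates of
  \<open>A y (B a v) - v\<close> vanish at y = a, so continuity of B suffices to differentiate
  there. The resulting formula contains B only undifferentiated, so each step of the induction gains
  one order.\<close>

lemma inverse_family_Ck_on:
  fixes A B :: "'a::euclidean_space \<Rightarrow> 'b::euclidean_space \<Rightarrow> 'b"
  assumes S: "open S" and lin: "\<And>y. y \<in> S \<Longrightarrow> linear (A y)"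
    and BA: "\<And>y v. y \<in> S \<Longrightarrow> B y (A y v) = v" and AB: "\<And>y v. y \<in> S \<Longrightarrow> A y (B y v) = v"
    and Ck: "\<And>v. Ck_on k S (\<lambda>y. A y v)"
  shows "Ck_on k S (\<lambda>y. B y v)"
  using Ck
proof (induction k arbitrary: v)
  case 0
  then show ?case
    using inverse_family_continuous[where A = A and B = B and v = v, OF S lin BA AB] by simp
next
  case (Suc k)
  let ?DA = "\<lambda>u y. frechet_derivative (\<lambda>y. A y u) (at y)"
  have CkA: "Ck_on k S (\<lambda>y. A y v)" for v
    using Suc.prems by (rule Ck_on_SucD)
  note CkB = Suc.IH[OF CkA]
  \<comment> \<open>The usual derivative of an inverse, minus \<open>B y\<close> after the
    derivative of A in direction h after \<open>B y\<close>, applied to v and expanded in the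
    basis.\<close>
  let ?D = "\<lambda>y h. - (\<Sum>b\<in>Basis. (\<Sum>b'\<in>Basis. (B y v \<bullet> b') * (?DA b' y h \<bullet> b)) *\<^sub>R B y b)"
  have der: "((\<lambda>y. B y v) has_derivative ?D a) (at a)" if a: "a \<in> S" for a
  proof -
    have linB: "linear (B y)" if "y \<in> S" for y
      using lin[OF that] BA[OF that] AB[OF that] by (auto simp: linear_iff) (metis)+
    have DA: "((\<lambda>y. A y u) has_derivative ?DA u a) (at a)" for u
      using Ck_on_has_derivative[OF Suc.prems a] .
    have sum_eq: "A y (B a v) = (\<Sum>b'\<in>Basis. (B a v \<bullet> b') *\<^sub>R A y b')" if "y \<in> S" for y
      using linear_euclidean_representation[OF lin[OF that]] .
    have "((\<lambda>y. (\<Sum>b'\<in>Basis. (B a v \<bullet> b') *\<^sub>R A y b') - v) has_derivative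
        (\<lambda>h. \<Sum>b'\<in>Basis. (B a v \<bullet> b') *\<^sub>R ?DA b' a h)) (at a)"
      by (auto intro!: derivative_eq_intros DA)
    then have a': "((\<lambda>y. (\<Sum>b'\<in>Basis. (B a v \<bullet> b') *\<^sub>R A y b') \<bullet> b - v \<bullet> b) has_derivative
        (\<lambda>h. \<Sum>b'\<in>Basis. (B a v \<bullet> b') * (?DA b' a h \<bullet> b))) (at a)" for b
      by (drule_tac has_derivative_inner_left[where b = b]) (simp add: inner_sum_left inner_diff_left)
    have "isCont (\<lambda>y. B y b) a" for b
      using CkB[of b] Ck_on_imp_continuous_on S a continuous_on_eq_continuous_at by blast
    then have "((\<lambda>y. B a v - (\<Sum>b\<in>Basis. ((\<Sum>b'\<in>Basis. (B a v \<bullet> b') *\<^sub>R A y b') \<bullet> b - v \<bullet> b) *\<^sub>R B y b))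
        has_derivative (\<lambda>h. 0 - (\<Sum>b\<in>Basis. (\<Sum>b'\<in>Basis. (B a v \<bullet> b') * (?DA b' a h \<bullet> b)) *\<^sub>R B a b))) (at a)"
      using AB[OF a] sum_eq[OF a]
      by (intro has_derivative_diff has_derivative_const has_derivative_sum
          has_derivative_scaleR_vanishing a') auto
    then have "((\<lambda>y. B a v - (\<Sum>b\<in>Basis. ((\<Sum>b'\<in>Basis. (B a v \<bullet> b') *\<^sub>R A y b') \<bullet> b - v \<bullet> b) *\<^sub>R B y b))
        has_derivative ?D a) (at a)"
      by simp
    then show ?thesis
    proof (rule has_derivative_transform_within_open[OF _ S a])
      fix y assume y: "y \<in> S"
      interpret linear "B y" using linB y by blast
      have "(\<Sum>b\<in>Basis. ((\<Sum>b'\<in>Basis. (B a v \<bullet> b') *\<^sub>R A y b') \<bullet> b - v \<bullet> b) *\<^sub>R B y b)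
          = (\<Sum>b\<in>Basis. ((A y (B a v) - v) \<bullet> b) *\<^sub>R B y b)"
        using sum_eq[OF y] by (simp add: inner_diff_left)
      also have "\<dots> = B y (A y (B a v) - v)"
        using linear_euclidean_representation[OF linB[OF y], of "A y (B a v) - v"] by simp
      also have "\<dots> = B a v - B y v"
        using BA[OF y] by (simp add: diff)
      finally show "B a v - (\<Sum>b\<in>Basis. ((\<Sum>b'\<in>Basis. (B a v \<bullet> b') *\<^sub>R A y b') \<bullet> b - v \<bullet> b) *\<^sub>R B y b)
          = B y v"
        by simp
    qed
  qed
  have inner: "Ck_on k S (\<lambda>y. f y \<bullet> b)" if "Ck_on k S f" for f :: "'a \<Rightarrow> 'b" and b
    by (rule Ck_on_compose_linear[OF bounded_linear_inner_left S that])
  show ?case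
    by (intro Ck_on_SucI[OF S der] Ck_on_compose_linear[OF bounded_linear_minus[OF bounded_linear_ident] S]
        Ck_on_sum[OF S] Ck_on_bilinear[OF bounded_bilinear_scaleR S]
        Ck_on_bilinear[OF bounded_bilinear_mult S] inner CkB Ck_on_frechet_derivative[OF Suc.prems])
qed


section \<open>The calculus rules for smooth maps\<close>

lemma smooth_onD: "smooth_on S f \<Longrightarrow> Ck_on k S f"
  by (simp add: smooth_on_def)

lemma smooth_on_subset: "smooth_on S f \<Longrightarrow> S' \<subseteq> S \<Longrightarrow> smooth_on S' f"
  unfolding smooth_on_def using Ck_on_subset by blast

lemma smooth_on_cong:
  assumes "open S" "\<And>x. x \<in> S \<Longrightarrow> f x = g x" "smooth_on S f"
  shows "smooth_on S g"
  using assms unfolding smooth_on_def by (blast intro: Ck_on_cong)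

lemma smooth_on_imp_continuous_on: "smooth_on S f \<Longrightarrow> continuous_on S f"
  using Ck_on_imp_continuous_on smooth_onD by blast

lemma smooth_on_has_derivative:
  "smooth_on S f \<Longrightarrow> x \<in> S \<Longrightarrow> (f has_derivative frechet_derivative f (at x)) (at x)"
  using Ck_on_has_derivative smooth_onD by blast

lemma smooth_on_frechet_derivative:
  "smooth_on S f \<Longrightarrow> smooth_on S (\<lambda>x. frechet_derivative f (at x) v)"
  using Ck_on_frechet_derivative unfolding smooth_on_def by blast

lemma smooth_on_const: "smooth_on S (\<lambda>x. c)"
  by (simp add: smooth_on_def Ck_on_const)

lemma smooth_on_bounded_linear: "bounded_linear L \<Longrightarrow> open S \<Longrightarrow> smooth_on S L"
  by (simp add: smooth_on_def Ck_on_bounded_linear)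

lemmas smooth_on_ident = smooth_on_bounded_linear[OF bounded_linear_ident]

lemma smooth_on_add:
  "open S \<Longrightarrow> smooth_on S f \<Longrightarrow> smooth_on S g \<Longrightarrow> smooth_on S (\<lambda>x. f x + g x)"
  by (simp add: smooth_on_def Ck_on_add)

lemma smooth_on_bilinear:
  "bounded_bilinear B \<Longrightarrow> open S \<Longrightarrow> smooth_on S f \<Longrightarrow> smooth_on S g \<Longrightarrow>
    smooth_on S (\<lambda>x. B (f x) (g x))"
  by (simp add: smooth_on_def Ck_on_bilinear)

lemma smooth_on_compose_linear:
  "bounded_linear L \<Longrightarrow> open S \<Longrightarrow> smooth_on S f \<Longrightarrow> smooth_on S (\<lambda>x. L (f x))"
  by (simp add: smooth_on_def Ck_on_compose_linear)

lemma smooth_on_compose: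
  "open S \<Longrightarrow> smooth_on S f \<Longrightarrow> smooth_on T g \<Longrightarrow> f ` S \<subseteq> T \<Longrightarrow> smooth_on S (\<lambda>x. g (f x))"
  unfolding smooth_on_def using Ck_on_compose by blast

lemma smooth_on_Pair:
  "open S \<Longrightarrow> smooth_on S f \<Longrightarrow> smooth_on S g \<Longrightarrow> smooth_on S (\<lambda>x. (f x, g x))"
  by (simp add: smooth_on_def Ck_on_Pair)

lemma smooth_on_fst: "open S \<Longrightarrow> smooth_on S f \<Longrightarrow> smooth_on S (\<lambda>x. fst (f x))"
  by (rule smooth_on_compose_linear[OF bounded_linear_fst])

lemma smooth_on_snd: "open S \<Longrightarrow> smooth_on S f \<Longrightarrow> smooth_on S (\<lambda>x. snd (f x))"
  by (rule smooth_on_compose_linear[OF bounded_linear_snd])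

lemma inverse_family_smooth_on:
  fixes A B :: "'a::euclidean_space \<Rightarrow> 'b::euclidean_space \<Rightarrow> 'b"
  assumes "open S" "\<And>y. y \<in> S \<Longrightarrow> linear (A y)"
    and "\<And>y v. y \<in> S \<Longrightarrow> B y (A y v) = v" "\<And>y v. y \<in> S \<Longrightarrow> A y (B y v) = v"
    and Ck: "\<And>v. smooth_on S (\<lambda>y. A y v)"
  shows "smooth_on S (\<lambda>y. B y v)"
  unfolding smooth_on_def
  using inverse_family_Ck_on[where A = A and B = B and v = v, OF assms(1-4) smooth_onD[OF Ck]]
  by blast


section \<open>Diffeomorphisms between open sets\<close>

lemma open_diffeo_imp_open: "open_diffeo U \<phi> \<Longrightarrow> open U"
  and open_diffeo_open_image: "open_diffeo U \<phi> \<Longrightarrow> open (\<phi> ` U)"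
  and open_diffeo_inj_on: "open_diffeo U \<phi> \<Longrightarrow> inj_on \<phi> U"
  and open_diffeo_smooth_on: "open_diffeo U \<phi> \<Longrightarrow> smooth_on U \<phi>"
  and open_diffeo_smooth_on_inv: "open_diffeo U \<phi> \<Longrightarrow> smooth_on (\<phi> ` U) (inv_into U \<phi>)"
  by (simp_all add: open_diffeo_def)

lemma open_diffeoI:
  assumes "open U" "open V" "smooth_on U f" "smooth_on V g"
    and "f ` U = V" "\<And>x. x \<in> U \<Longrightarrow> g (f x) = x"
  shows "open_diffeo U f"
proof -
  have inj: "inj_on f U"
    using assms(6) by (rule inj_on_inverseI)
  have "smooth_on (f ` U) (inv_into U f)"
    using assms inj by (intro smooth_on_cong[OF _ _ assms(4)[folded assms(5)]]) auto
  then show ?thesis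
    using assms inj by (simp add: open_diffeo_def)
qed

lemma open_diffeo_subset:
  assumes \<phi>: "open_diffeo U \<phi>" and V: "open V" "V \<subseteq> U"
  shows "open_diffeo V \<phi>"
proof (rule open_diffeoI[OF V(1) _ _ _ refl])
  show sm: "smooth_on V \<phi>"
    using open_diffeo_smooth_on[OF \<phi>] V(2) by (rule smooth_on_subset)
  show "open (\<phi> ` V)"
    using smooth_on_imp_continuous_on[OF sm] V(1) inj_on_subset[OF open_diffeo_inj_on[OF \<phi>] V(2)]
    by (rule invariance_of_domain)
  show "smooth_on (\<phi> ` V) (inv_into U \<phi>)"
    using open_diffeo_smooth_on_inv[OF \<phi>] V(2) by (blast intro: smooth_on_subset)
  show "inv_into U \<phi> (\<phi> x) = x" if "x \<in> V" for x
    using open_diffeo_inj_on[OF \<phi>] V(2) that by auto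
qed

lemma open_diffeo_compose:
  assumes \<phi>: "open_diffeo U \<phi>" and \<psi>: "open_diffeo V \<psi>" and sub: "\<phi> ` U \<subseteq> V"
  shows "open_diffeo U (\<lambda>x. \<psi> (\<phi> x))"
proof (rule open_diffeoI[where V = "\<psi> ` (\<phi> ` U)" and g = "\<lambda>y. inv_into U \<phi> (inv_into V \<psi> y)"])
  have *: "open_diffeo (\<phi> ` U) \<psi>"
    using \<psi> open_diffeo_open_image[OF \<phi>] sub by (rule open_diffeo_subset)
  show "open U" "open (\<psi> ` (\<phi> ` U))"
    using \<phi> * by (simp_all add: open_diffeo_def)
  show "smooth_on U (\<lambda>x. \<psi> (\<phi> x))"
    using \<phi> \<psi> sub by (auto simp: open_diffeo_def intro: smooth_on_compose)
  have inv: "inv_into V \<psi> (\<psi> y) = y" if "y \<in> \<phi> ` U" for y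
    using sub open_diffeo_inj_on[OF \<psi>] that by auto
  have "smooth_on (\<psi> ` (\<phi> ` U)) (inv_into V \<psi>)"
    using open_diffeo_smooth_on_inv[OF \<psi>] sub by (blast intro: smooth_on_subset)
  then show "smooth_on (\<psi> ` (\<phi> ` U)) (\<lambda>y. inv_into U \<phi> (inv_into V \<psi> y))"
  proof (rule smooth_on_compose[where f = "inv_into V \<psi>" and T = "\<phi> ` U",
        OF open_diffeo_open_image[OF *] _ open_diffeo_smooth_on_inv[OF \<phi>]])
    show "inv_into V \<psi> ` \<psi> ` \<phi> ` U \<subseteq> \<phi> ` U"
      using inv by force
  qed
  show "inv_into U \<phi> (inv_into V \<psi> (\<psi> (\<phi> x))) = x" if "x \<in> U" for x
    using inv that open_diffeo_inj_on[OF \<phi>] by auto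
qed auto

lemma open_diffeo_inv_into:
  assumes "open_diffeo U \<phi>"
  shows "open_diffeo (\<phi> ` U) (inv_into U \<phi>)"
  using assms
  by (intro open_diffeoI[where V = U and g = \<phi>])
    (auto simp: open_diffeo_def f_inv_into_f inv_into_image_cancel)

text \<open>The chain rule makes \<open>D'\<close> a left inverse of D; in finite dimension a left
  inverse of an endomorphism is two-sided.\<close>

lemma open_diffeo_has_derivative_inv_into:
  assumes \<phi>: "open_diffeo U \<phi>" and x: "x \<in> U"
  obtains D D' where "(\<phi> has_derivative D) (at x)"
    "(inv_into U \<phi> has_derivative D') (at (\<phi> x))" "D' \<circ> D = id" "D \<circ> D' = id"
proof -
  let ?\<psi> = "inv_into U \<phi>"
  let ?D = "frechet_derivative \<phi> (at x)" and ?D' = "frechet_derivative ?\<psi> (at (\<phi> x))"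
  have D: "(\<phi> has_derivative ?D) (at x)"
    using open_diffeo_smooth_on[OF \<phi>] x by (rule smooth_on_has_derivative)
  have D': "(?\<psi> has_derivative ?D') (at (\<phi> x))"
    using open_diffeo_smooth_on_inv[OF \<phi>] x by (intro smooth_on_has_derivative) auto
  have "((\<lambda>z. ?\<psi> (\<phi> z)) has_derivative (\<lambda>v. ?D' (?D v))) (at x)"
    using D D' by (rule has_derivative_compose)
  then have "((\<lambda>z. z) has_derivative (\<lambda>v. ?D' (?D v))) (at x)"
    by (rule has_derivative_transform_within_open[OF _ open_diffeo_imp_open[OF \<phi>] x])
      (simp add: open_diffeo_inj_on[OF \<phi>])
  then have 1: "?D' \<circ> ?D = id"
    using has_derivative_unique has_derivative_ident unfolding comp_def id_def by blast
  then have "?D \<circ> ?D' = id"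
    using D D' has_derivative_linear linear_inverse_left by blast
  with D D' 1 show ?thesis by (rule that)
qed

lemma open_diffeo_derivative_bij:
  assumes "open_diffeo U \<phi>" "x \<in> U"
  shows "bij (frechet_derivative \<phi> (at x))"
  using open_diffeo_has_derivative_inv_into[OF assms]
  by (metis frechet_derivative_at o_bij)

text \<open>Smoothness of the inverse g is bootstrapped. Its derivative at y is the inverse of the
  derivative of f at \<open>g y\<close>; if g is of class C^k, so is this family of inverses, and
  hence g is of class C^(k+1).\<close>

lemma open_diffeo_of_inj_derivative:
  fixes f :: "'a::euclidean_space \<Rightarrow> 'a"
  assumes S: "open S" and f: "smooth_on S f" "inj_on f S"
    and inj: "\<And>x. x \<in> S \<Longrightarrow> inj (frechet_derivative f (at x))"
  shows "open_diffeo S f"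
proof -
  let ?g = "inv_into S f" and ?f' = "\<lambda>x. frechet_derivative f (at x)"
  have cont: "continuous_on (f ` S) ?g"
    using continuous_on_inverse_open[OF S smooth_on_imp_continuous_on[OF f(1)]] f(2) by auto
  have op: "open (f ` S)"
    using smooth_on_imp_continuous_on[OF f(1)] S f(2) by (rule invariance_of_domain)
  have lin: "linear (?f' x)" if "x \<in> S" for x
    using smooth_on_has_derivative[OF f(1) that] has_derivative_linear by blast
  have bij: "bij (?f' x)" if "x \<in> S" for x
    using linear_injective_imp_surjective[OF lin[OF that] inj[OF that]] inj[OF that] by (simp add: bij_def)
  have gS: "?g y \<in> S" if "y \<in> f ` S" for y
    using that by (rule inv_into_into)
  let ?B = "\<lambda>y. inv (?f' (?g y))"
  have der: "(?g has_derivative ?B y) (at y)" if y: "y \<in> f ` S" for y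
  proof (rule has_derivative_inverse_strong_x[where f = f and g = ?g and y = y, OF S gS[OF y] smooth_on_imp_continuous_on[OF f(1)]])
    show "(f has_derivative ?f' (?g y)) (at (?g y))"
      using f(1) gS[OF y] by (rule smooth_on_has_derivative)
    show "?f' (?g y) \<circ> ?B y = id"
      using bij[OF gS[OF y]] by (simp add: bij_is_surj flip: surj_iff)
  qed (use y f(2) f_inv_into_f in auto)
  have "Ck_on k (f ` S) ?g" for k
  proof (induction k)
    case 0
    then show ?case using cont by simp
  next
    case (Suc k)
    have "?g ` f ` S \<subseteq> S"
      using gS by blast
    then have "Ck_on k (f ` S) (\<lambda>y. ?f' (?g y) v)" for v
      by (rule Ck_on_compose[OF op Suc smooth_onD[OF smooth_on_frechet_derivative[OF f(1)]]])
    then have "Ck_on k (f ` S) (\<lambda>y. ?B y v)" for v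
    proof (intro inverse_family_Ck_on[where A = "\<lambda>y. ?f' (?g y)" and B = ?B and v = v, OF op])
      fix y v assume "y \<in> f ` S"
      then have "?g y \<in> S" by (rule gS)
      then show "linear (?f' (?g y))" "?B y (?f' (?g y) v) = v" "?f' (?g y) (?B y v) = v"
        using lin bij by (simp_all add: bij_is_inj bij_is_surj surj_f_inv_f)
    qed
    with der show ?case
      by (rule Ck_on_SucI[where f' = ?B, OF op])
  qed
  then show ?thesis
    using S f op by (simp add: open_diffeo_def smooth_on_def)
qed

text \<open>The C^1 inverse function theorem yields a homeomorphism near a with invertible
  derivatives, and \<open>open_diffeo_of_inj_derivative\<close> upgrades it to a smooth
  diffeomorphism.\<close>

lemma smooth_inverse_function_theorem:
  fixes f :: "'a::euclidean_space \<Rightarrow> 'a"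
  assumes U: "open U" "a \<in> U" and f: "smooth_on U f"
    and inj: "inj (frechet_derivative f (at a))"
  obtains N where "a \<in> N" "N \<subseteq> U" "open_diffeo N f"
proof -
  let ?f' = "\<lambda>x. frechet_derivative f (at x)"
  have der: "(f has_derivative ?f' x) (at x)" if "x \<in> U" for x
    using f that by (rule smooth_on_has_derivative)
  have bl: "bounded_linear (?f' x)" if "x \<in> U" for x
    using der[OF that] by (rule has_derivative_bounded_linear)
  let ?F = "\<lambda>x. Blinfun (?f' x)"
  obtain h where h: "linear h" "h \<circ> ?f' a = id"
    using linear_injective_left_inverse[OF _ inj] bl[OF U(2)] bounded_linear.linear by blast
  \<comment> \<open>Continuity in the operator norm is checked on the basis vectors.\<close>
  have "continuous_on U ?F"
  proof (rule continuous_on_blinfun_componentwise)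
    fix i :: 'a
    have "continuous_on U (\<lambda>x. ?f' x i)"
      using smooth_on_imp_continuous_on[OF smooth_on_frechet_derivative[OF f]] .
    then show "continuous_on U (\<lambda>x. blinfun_apply (?F x) i)"
      by (simp add: bounded_linear_Blinfun_apply[OF bl] cong: continuous_on_cong)
  qed
  moreover have "(f has_derivative blinfun_apply (?F x)) (at x)" if "x \<in> U" for x
    using der[OF that] bounded_linear_Blinfun_apply[OF bl[OF that]] by simp
  moreover have "Blinfun h o\<^sub>L ?F a = id_blinfun"
    using h bounded_linear_Blinfun_apply[OF bl[OF U(2)]] bounded_linear_Blinfun_apply[of h]
    by (intro blinfun_eqI) (simp add: linear_conv_bounded_linear pointfree_idE)
  ultimately obtain N V g g' where N: "open N" "N \<subseteq> U" "a \<in> N" and hom: "homeomorphism N V f g"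
    and bij: "\<And>y. y \<in> V \<Longrightarrow> bij (blinfun_apply (?F (g y)))"
    using inverse_function_theorem[OF U(1) _ _ U(2), of f ?F "Blinfun h"] by metis
  have "open_diffeo N f"
  proof (rule open_diffeo_of_inj_derivative[OF N(1) smooth_on_subset[OF f N(2)]])
    show "inj_on f N"
      using hom by (metis homeomorphism_apply1 inj_on_inverseI)
    fix x assume x: "x \<in> N"
    then have "f x \<in> V" "g (f x) = x"
      using hom by (auto simp: homeomorphism_def)
    then show "inj (?f' x)"
      using bij[of "f x"] bounded_linear_Blinfun_apply[OF bl, of x] x N(2)
      by (auto simp: bij_is_inj)
  qed
  then show ?thesis
    using N by (intro that)
qed


section \<open>Embedded and immersed submanifolds\<close>

text \<open>The slice condition is localized at a point, so that it can be established at one point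
  and carried to others by diffeomorphisms. Stating it through membership makes it easy to pull
  back.\<close>

definition embedded_at :: "nat \<Rightarrow> 'a::euclidean_space set \<Rightarrow> 'a \<Rightarrow> bool" where
  "embedded_at k S p \<longleftrightarrow> (\<exists>U \<phi> L. p \<in> U \<and> open_diffeo U \<phi> \<and> subspace L \<and> dim L = k \<and>
     (\<forall>x\<in>U. x \<in> S \<longleftrightarrow> \<phi> x \<in> L))"

lemma embedded_submanifold_iff: "embedded_submanifold k S \<longleftrightarrow> (\<forall>p\<in>S. embedded_at k S p)"
proof -
  have "(\<phi> ` (U \<inter> S) = \<phi> ` U \<inter> L) = (\<forall>x\<in>U. x \<in> S \<longleftrightarrow> \<phi> x \<in> L)" (is "?l = ?r")
    if "open_diffeo U \<phi>" for U L and \<phi> :: "'a \<Rightarrow> 'a"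
  proof
    have mem: "\<phi> x \<in> \<phi> ` (U \<inter> S) \<longleftrightarrow> x \<in> S" if "x \<in> U" for x
      using inj_on_image_mem_iff[OF open_diffeo_inj_on[OF \<open>open_diffeo U \<phi>\<close>], of x "U \<inter> S"] that
      by blast
    show ?r if ?l
      using mem that by blast
    show ?l if ?r
      using that by blast
  qed
  then show ?thesis
    unfolding embedded_submanifold_def embedded_at_def by (simp cong: conj_cong)
qed

lemma embedded_at_diffeo:
  assumes \<Psi>: "open_diffeo N \<Psi>" "p \<in> N" and emb: "embedded_at k S' (\<Psi> p)"
    and S: "\<And>x. x \<in> N \<Longrightarrow> x \<in> S \<longleftrightarrow> \<Psi> x \<in> S'"
  shows "embedded_at k S p"
proof -
  obtain U \<phi> L where U: "\<Psi> p \<in> U" "open_diffeo U \<phi>" and L: "subspace L" "dim L = k"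
    and UL: "\<forall>x\<in>U. x \<in> S' \<longleftrightarrow> \<phi> x \<in> L"
    using emb unfolding embedded_at_def by blast
  let ?V = "N \<inter> \<Psi> -` U"
  have "open ?V"
    using smooth_on_imp_continuous_on[OF open_diffeo_smooth_on[OF \<Psi>(1)]]
      open_diffeo_imp_open[OF \<Psi>(1)] open_diffeo_imp_open[OF U(2)]
    by (rule continuous_open_preimage)
  then have "open_diffeo ?V (\<lambda>x. \<phi> (\<Psi> x))"
    by (intro open_diffeo_compose[OF open_diffeo_subset[OF \<Psi>(1)] U(2)]) auto
  then show ?thesis
    unfolding embedded_at_def using U(1) \<Psi>(2) L UL S
    by (intro exI[of _ ?V] exI[of _ "\<lambda>x. \<phi> (\<Psi> x)"] exI[of _ L]) auto
qed

lemma open_diffeo_ident: "open N \<Longrightarrow> open_diffeo N (\<lambda>x. x)"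
  by (rule open_diffeoI[where V = N and g = "\<lambda>x. x"]) (auto intro: smooth_on_ident)

lemma embedded_at_local:
  assumes "embedded_at k S p" "open N" "p \<in> N" "S \<inter> N = S' \<inter> N"
  shows "embedded_at k S' p"
  by (rule embedded_at_diffeo[OF open_diffeo_ident, OF assms(2,3,1)]) (use assms(4) in blast)

lemma embedded_submanifold_open:
  assumes "open S"
  shows "embedded_submanifold DIM('a) (S :: 'a::euclidean_space set)"
  unfolding embedded_submanifold_iff embedded_at_def
proof
  fix p assume "p \<in> S"
  then show "\<exists>U \<phi> L. p \<in> U \<and> open_diffeo U \<phi> \<and> subspace L \<and> dim L = DIM('a) \<and>
      (\<forall>x\<in>U. x \<in> S \<longleftrightarrow> \<phi> x \<in> L)"
    using open_diffeo_ident[OF assms]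
    by (intro exI[of _ S] exI[of _ "\<lambda>x. x"] exI[of _ UNIV]) simp
qed

text \<open>Q is the identity minus the orthogonal projection onto L. It turns the slice condition
  into an equation that can be differentiated.\<close>

lemma kernel_subspace_exists:
  fixes L :: "'a::euclidean_space set"
  assumes "subspace L"
  obtains Q :: "'a \<Rightarrow> 'a" where "linear Q" "\<And>x. Q x = 0 \<longleftrightarrow> x \<in> L"
proof -
  obtain B where B: "B \<subseteq> L" "pairwise orthogonal B" "\<And>x. x \<in> B \<Longrightarrow> norm x = 1"
      "independent B" "span B = L"
    using orthonormal_basis_subspace[OF assms] by metis
  have fin: "finite B"
    using B(4) by (rule independent_imp_finite)
  let ?P = "\<lambda>x. \<Sum>b\<in>B. (x \<bullet> b) *\<^sub>R b"
  have lin: "linear ?P"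
    by (rule linearI) (auto simp: inner_add_left scaleR_add_left sum.distrib scaleR_sum_right)
  have in_L: "?P x \<in> L" for x
    using B(1) assms by (auto intro!: subspace_sum subspace_scale)
  have fix_B: "?P c = c" if "c \<in> B" for c
  proof -
    have "?P c = (\<Sum>b\<in>B. if b = c then c else 0)"
      using B(2,3) that
      by (intro sum.cong) (auto simp: pairwise_def orthogonal_def inner_commute norm_eq_1)
    then show ?thesis using fin that by simp
  qed
  have "?P x = x" if "x \<in> span B" for x
    using linear_eq_on[OF lin linear_id that] fix_B by simp
  then have "x - ?P x = 0 \<longleftrightarrow> x \<in> L" for x
    using in_L[of x] B(5) by auto
  moreover have "linear (\<lambda>x. x - ?P x)"
    using lin by (intro linear_compose_sub linear_ident)
  ultimately show ?thesis
    by (rule that[rotated])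
qed

text \<open>The chart of \<open>S\<close> is \<open>\<theta> c = c + R (h c - H c)\<close>, where \<open>h\<close> is a local equation of
  \<open>D \<times> S\<close> restricted to \<open>{d} \<times> S\<close>, \<open>H\<close> its derivative at the base point and \<open>R\<close> a right inverse
  of \<open>H\<close> on its range.  The product structure makes \<open>H\<close> have the same range as the derivative of
  the full equation; hence \<open>H (\<theta> c) = h c\<close>, and \<open>\<theta>\<close> straightens \<open>S\<close> to the kernel of \<open>H\<close>.\<close>

lemma embedded_at_factor:
  fixes D :: "'a::euclidean_space set" and S :: "'b::euclidean_space set"
  assumes emb: "embedded_at k (D \<times> S) (d, c)" and D: "open D" "d \<in> D" and c: "c \<in> S"
  shows "\<exists>j. embedded_at j S c"
proof -
  obtain U \<phi> L where U: "(d, c) \<in> U" and \<phi>: "open_diffeo U \<phi>" and L: "subspace L"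
    and UL: "\<forall>x\<in>U. x \<in> D \<times> S \<longleftrightarrow> \<phi> x \<in> L"
    using emb unfolding embedded_at_def by blast
  obtain Q :: "'a \<times> 'b \<Rightarrow> 'a \<times> 'b" where Q: "linear Q" "\<And>x. Q x = 0 \<longleftrightarrow> x \<in> L"
    using kernel_subspace_exists[OF L] by blast
  note U_open = open_diffeo_imp_open[OF \<phi>]
  let ?\<phi>' = "frechet_derivative \<phi> (at (d, c))"
  have \<phi>': "(\<phi> has_derivative ?\<phi>') (at (d, c))"
    using open_diffeo_smooth_on[OF \<phi>] U by (rule smooth_on_has_derivative)
  note lin\<phi>' = has_derivative_linear[OF \<phi>']
  have blQ: "bounded_linear Q"
    using Q(1) by (simp add: linear_conv_bounded_linear)
  define h where "h y = Q (\<phi> (d, y))" for y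
  define H where "H v = Q (?\<phi>' (0, v))" for v
  let ?V = "Pair d -` U"
  have V: "open ?V" "c \<in> ?V"
    using U U_open by (auto intro!: open_vimage continuous_intros)
  have "smooth_on ?V (\<lambda>y. \<phi> (d, y))"
    using V(1) by (intro smooth_on_compose[where f = "Pair d" and g = \<phi>, OF _ _ open_diffeo_smooth_on[OF \<phi>]]
      smooth_on_Pair smooth_on_const smooth_on_ident) auto
  then have h_smooth: "smooth_on ?V h"
    unfolding h_def by (rule smooth_on_compose_linear[OF blQ V(1)])
  have linH: "linear H"
    unfolding H_def
    by (rule linear_compose[OF linear_compose[of "Pair 0" ?\<phi>'] Q(1), unfolded o_def])
       (auto intro: linearI lin\<phi>')
  have h': "(h has_derivative H) (at c)"
  proof -
    have "(Pair d has_derivative (\<lambda>v. (0, v))) (at c)"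
      by (auto intro!: derivative_eq_intros)
    then have "((\<lambda>y. \<phi> (d, y)) has_derivative (\<lambda>v. ?\<phi>' (0, v))) (at c)"
      using \<phi>' by (rule has_derivative_compose)
    then show ?thesis
      unfolding h_def H_def by (rule bounded_linear.has_derivative[OF blQ])
  qed
  \<comment> \<open>Near d the slice of points \<open>(x, c)\<close> lies in
    \<open>D \<times> S\<close>, because D is open. So the equation vanishes identically along
    it.\<close>
  have horizontal: "Q (?\<phi>' (v, 0)) = 0" for v
  proof -
    let ?W = "(\<lambda>x. (x, c)) -` U \<inter> D"
    have W: "open ?W" "d \<in> ?W"
      using U U_open D by (auto intro!: open_Int open_vimage continuous_intros)
    have "((\<lambda>x. (x, c)) has_derivative (\<lambda>v. (v, 0))) (at d)"
      by (auto intro!: derivative_eq_intros)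
    then have "((\<lambda>x. \<phi> (x, c)) has_derivative (\<lambda>v. ?\<phi>' (v, 0))) (at d)"
      using \<phi>' by (rule has_derivative_compose)
    then have "((\<lambda>x. Q (\<phi> (x, c))) has_derivative (\<lambda>v. Q (?\<phi>' (v, 0)))) (at d)"
      by (rule bounded_linear.has_derivative[OF blQ])
    then have "((\<lambda>x. 0) has_derivative (\<lambda>v. Q (?\<phi>' (v, 0)))) (at d)"
      by (rule has_derivative_transform_within_open[OF _ W]) (use Q(2) UL c in auto)
    then have "(\<lambda>v. Q (?\<phi>' (v, 0))) = (\<lambda>v. 0)"
      using has_derivative_unique has_derivative_const by blast
    then show ?thesis by metis
  qed
  have range: "Q z \<in> range H" for z
  proof -
    have "surj ?\<phi>'"
      using open_diffeo_derivative_bij[OF \<phi> U] by (rule bij_is_surj)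
    then obtain v w where z: "z = ?\<phi>' (v, w)"
      by (metis surj_def surj_pair)
    have "?\<phi>' (v, w) = ?\<phi>' (v, 0) + ?\<phi>' (0, w)"
      using linear_add[OF lin\<phi>', of "(v, 0)" "(0, w)"] by simp
    then have "Q z = H w"
      using horizontal z by (simp add: H_def linear_add[OF Q(1)])
    then show ?thesis by simp
  qed
  obtain R where R: "linear R" "\<And>z. z \<in> range H \<Longrightarrow> H (R z) = z"
    using linear_exists_right_inverse_on[OF linH subspace_UNIV] by blast
  have blR: "bounded_linear R" and blH: "bounded_linear H"
    using R(1) linH by (simp_all add: linear_conv_bounded_linear)
  define \<theta> where "\<theta> y = y + R (h y + - H y)" for y
  have \<theta>_smooth: "smooth_on ?V \<theta>"
    unfolding \<theta>_def
    by (intro smooth_on_add smooth_on_ident smooth_on_compose_linear[OF blR]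
        smooth_on_compose_linear[OF bounded_linear_minus[OF bounded_linear_ident]]
        smooth_on_bounded_linear[OF blH] h_smooth V(1))
  have "(\<theta> has_derivative (\<lambda>v. v + R (H v + - H v))) (at c)"
    unfolding \<theta>_def
    by (intro has_derivative_add has_derivative_ident bounded_linear.has_derivative[OF blR]
        has_derivative_minus h' bounded_linear_imp_has_derivative[OF blH])
  \<comment> \<open>The correction term has derivative 0 at c, as h and H agree there to first
    order.\<close>
  then have "(\<theta> has_derivative (\<lambda>v. v)) (at c)"
    by (simp add: linear_0[OF R(1)])
  then have "frechet_derivative \<theta> (at c) = (\<lambda>v. v)"
    by (metis frechet_derivative_at)
  then obtain N where N: "c \<in> N" "N \<subseteq> ?V" "open_diffeo N \<theta>"
    using smooth_inverse_function_theorem[OF V \<theta>_smooth] by (metis inj_on_id2)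
  have "H (\<theta> y) = h y" for y
  proof -
    have "H (R (Q (\<phi> (d, y)) + - H y)) = Q (\<phi> (d, y)) + - H y"
    proof (rule R(2))
      obtain w where "Q (\<phi> (d, y)) = H w" using range by blast
      then have "Q (\<phi> (d, y)) + - H y = H (w - y)"
        by (simp add: linear_diff[OF linH])
      then show "Q (\<phi> (d, y)) + - H y \<in> range H" by simp
    qed
    then show ?thesis
      by (simp add: \<theta>_def h_def linear_add[OF linH])
  qed
  then have "\<forall>y\<in>N. y \<in> S \<longleftrightarrow> \<theta> y \<in> {v. H v = 0}"
    using N(2) UL Q(2) D(2) by (auto simp: h_def)
  then show ?thesis
    unfolding embedded_at_def using N linear_subspace_kernel[OF linH] by blast
qed

text \<open>Invariance of domain, applied in slice charts.\<close>

lemma embedded_subset_openin: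
  assumes S: "embedded_submanifold k S" and P: "embedded_submanifold k P" and "P \<subseteq> S"
  shows "openin (top_of_set S) P"
proof (subst openin_subopen, intro ballI)
  fix p assume p: "p \<in> P"
  obtain U \<phi> L where U: "p \<in> U" "open_diffeo U \<phi>" and L: "subspace L" "dim L = k"
    and UL: "\<forall>x\<in>U. x \<in> S \<longleftrightarrow> \<phi> x \<in> L"
    using S p \<open>P \<subseteq> S\<close> unfolding embedded_submanifold_iff embedded_at_def by blast
  obtain U' \<phi>' L' where U': "p \<in> U'" "open_diffeo U' \<phi>'" and L': "subspace L'" "dim L' = k"
    and UL': "\<forall>x\<in>U'. x \<in> P \<longleftrightarrow> \<phi>' x \<in> L'"
    using P p unfolding embedded_submanifold_iff embedded_at_def by blast
  let ?N = "U \<inter> U'" and ?g = "inv_into U' \<phi>'"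
  have N: "open ?N"
    using U U' open_diffeo_imp_open by blast
  note \<phi>N = open_diffeo_subset[OF U(2) N Int_lower1]
  note \<phi>'N = open_diffeo_subset[OF U'(2) N Int_lower2]
  let ?A = "\<phi>' ` ?N \<inter> L'"
  have g: "?g (\<phi>' x) = x" if "x \<in> ?N" for x
    using that open_diffeo_inj_on[OF U'(2)] by simp
  have gA: "?g ` ?A = ?N \<inter> P"
    using UL' g by (force simp: image_iff)
  \<comment> \<open>The transition map sends an open piece of \<open>L'\<close> continuously and
    injectively into L; as the dimensions agree, the image is open in L.\<close>
  have "openin (top_of_set L) ((\<lambda>y. \<phi> (?g y)) ` ?A)"
  proof (rule invariance_of_domain_subspaces[OF _ L'(1) L(1)])
    show "openin (top_of_set L') ?A"
      using open_diffeo_open_image[OF \<phi>'N] by (auto simp: openin_open)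
    show "dim L \<le> dim L'"
      using L L' by simp
    have "continuous_on ?A ?g"
      using smooth_on_imp_continuous_on[OF open_diffeo_smooth_on_inv[OF U'(2)]]
      by (rule continuous_on_subset) auto
    moreover have "continuous_on (?g ` ?A) \<phi>"
      using smooth_on_imp_continuous_on[OF open_diffeo_smooth_on[OF U(2)]] gA
      by (auto intro: continuous_on_subset)
    ultimately show "continuous_on ?A (\<lambda>y. \<phi> (?g y))"
      using continuous_on_compose2 by blast
    show "(\<lambda>y. \<phi> (?g y)) \<in> ?A \<rightarrow> L"
      using gA UL \<open>P \<subseteq> S\<close> by blast
    show "inj_on (\<lambda>y. \<phi> (?g y)) ?A"
    proof (rule inj_onI)
      fix y1 y2 assume "y1 \<in> ?A" "y2 \<in> ?A" and *: "\<phi> (?g y1) = \<phi> (?g y2)"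
      then obtain x1 x2 where "y1 = \<phi>' x1" "y2 = \<phi>' x2" "x1 \<in> ?N" "x2 \<in> ?N"
        by blast
      moreover from this have "x1 = x2"
        using * g inj_onD[OF open_diffeo_inj_on[OF \<phi>N], of x1 x2] by simp
      ultimately show "y1 = y2" by simp
    qed
  qed
  then obtain O1 where O1: "open O1" "(\<lambda>y. \<phi> (?g y)) ` ?A = L \<inter> O1"
    by (auto simp: openin_open)
  have "(\<lambda>y. \<phi> (?g y)) ` ?A = \<phi> ` (?N \<inter> P)"
    unfolding gA[symmetric] by (simp add: image_image)
  then have \<phi>P: "\<phi> ` (?N \<inter> P) = L \<inter> O1"
    using O1(2) by simp
  \<comment> \<open>By injectivity of \<phi> on \<open>?N\<close>, this open set meets S exactly in
    \<open>?N \<inter> P\<close>.\<close>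
  let ?O2 = "?N \<inter> \<phi> -` O1"
  have "open ?O2"
    using smooth_on_imp_continuous_on[OF open_diffeo_smooth_on[OF \<phi>N]] N O1(1)
    by (rule continuous_open_preimage)
  moreover have "S \<inter> ?O2 = ?N \<inter> P"
  proof
    show "S \<inter> ?O2 \<subseteq> ?N \<inter> P"
    proof
      fix x assume x: "x \<in> S \<inter> ?O2"
      then have "\<phi> x \<in> \<phi> ` (?N \<inter> P)"
        unfolding \<phi>P using UL by auto
      then show "x \<in> ?N \<inter> P"
        using x open_diffeo_inj_on[OF \<phi>N] by (auto simp: inj_on_def)
    qed
    show "?N \<inter> P \<subseteq> S \<inter> ?O2"
      using \<phi>P \<open>P \<subseteq> S\<close> by blast
  qed
  ultimately have "openin (top_of_set S) (?N \<inter> P)"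
    by (metis openin_open)
  then show "\<exists>T. openin (top_of_set S) T \<and> p \<in> T \<and> T \<subseteq> P"
    using p U U' by blast
qed

text \<open>Each chart domain P is embedded with the same dimension k as the whole set, so it is
  also open in the subspace topology. Both topologies induce the same topology on P, and therefore
  they agree.\<close>

lemma immersed_topology_eq:
  assumes T: "immersed_submanifold k T" and emb: "embedded_submanifold k (topspace T)"
  shows "T = top_of_set (topspace T)"
proof (rule topology_eq[THEN iffD2, rule_format], rule iffI)
  have chart: "\<exists>P. openin T P \<and> p \<in> P \<and> subtopology T P = top_of_set P \<and> openin (top_of_set (topspace T)) P"
    if "p \<in> topspace T" for p
    using T that embedded_subset_openin[OF emb] openin_subset
    unfolding immersed_submanifold_def by metis
  fix W
  show "openin (top_of_set (topspace T)) W" if W: "openin T W"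
  proof (subst openin_subopen, intro ballI)
    fix p assume p: "p \<in> W"
    then have "p \<in> topspace T"
      using openin_subset[OF W] by blast
    from chart[OF this] obtain P where P: "openin T P" "p \<in> P" "subtopology T P = top_of_set P"
      "openin (top_of_set (topspace T)) P"
      by blast
    have "openin (subtopology T P) (P \<inter> W)"
      using W openin_subtopology_Int2 by blast
    then have "openin (top_of_set (topspace T)) (P \<inter> W)"
      using P openin_trans by metis
    then show "\<exists>T'. openin (top_of_set (topspace T)) T' \<and> p \<in> T' \<and> T' \<subseteq> W"
      using p P by blast
  qed
  show "openin T W" if W: "openin (top_of_set (topspace T)) W"
  proof (subst openin_subopen, intro ballI)
    fix p assume p: "p \<in> W"
    then have "p \<in> topspace T"
      using openin_imp_subset[OF W] by blast
    from chart[OF this] obtain P where P: "openin T P" "p \<in> P" "subtopology T P = top_of_set P"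
      by blast
    obtain O' where O': "open O'" "W = topspace T \<inter> O'"
      using W by (auto simp: openin_open)
    have "openin (subtopology T P) (P \<inter> O')"
      using O'(1) P(3) by (auto simp: openin_open)
    then have "openin T (P \<inter> O')"
      using P(1) by (simp add: openin_open_subtopology)
    then show "\<exists>T'. openin T T' \<and> p \<in> T' \<and> T' \<subseteq> W"
      using p P O' openin_subset[OF P(1)] by blast
  qed
qed

text \<open>C is the preimage in a slice chart of a closed ball of L. Such sets are the compact
  pieces to which the Baire argument is applied.\<close>

lemma embedded_at_compact_neighbourhood:
  assumes "embedded_at k S p" "p \<in> S"
  obtains C N where "compact C" "C \<subseteq> S" "open N" "p \<in> N" "S \<inter> N \<subseteq> C"
proof -
  obtain U \<phi> L where U: "p \<in> U" "open_diffeo U \<phi>" and L: "subspace L"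
    and UL: "\<forall>x\<in>U. x \<in> S \<longleftrightarrow> \<phi> x \<in> L"
    using assms(1) unfolding embedded_at_def by blast
  let ?g = "inv_into U \<phi>"
  obtain e where e: "e > 0" "cball (\<phi> p) e \<subseteq> \<phi> ` U"
    using open_diffeo_open_image[OF U(2)] U(1) open_contains_cball by blast
  let ?K = "cball (\<phi> p) e \<inter> L"
  have "compact ?K"
    using closed_subspace[OF L] by (simp add: compact_Int_closed)
  moreover have "continuous_on ?K ?g"
    using smooth_on_imp_continuous_on[OF open_diffeo_smooth_on_inv[OF U(2)]] e(2)
    by (blast intro: continuous_on_subset)
  ultimately have 1: "compact (?g ` ?K)"
    by (rule compact_continuous_image[rotated])
  have 2: "?g ` ?K \<subseteq> S"
    using e(2) UL by (auto simp: f_inv_into_f inv_into_into subset_iff)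
  have "open (U \<inter> \<phi> -` ball (\<phi> p) e)"
    using smooth_on_imp_continuous_on[OF open_diffeo_smooth_on[OF U(2)]] open_diffeo_imp_open[OF U(2)]
    by (intro continuous_open_preimage) auto
  moreover have "S \<inter> (U \<inter> \<phi> -` ball (\<phi> p) e) \<subseteq> ?g ` ?K"
  proof
    fix x assume x: "x \<in> S \<inter> (U \<inter> \<phi> -` ball (\<phi> p) e)"
    then have "x = ?g (\<phi> x)" "\<phi> x \<in> ?K"
      using open_diffeo_inj_on[OF U(2)] UL by auto
    then show "x \<in> ?g ` ?K" by blast
  qed
  ultimately show ?thesis
    using 1 2 U(1) e(1) by (intro that[of "?g ` ?K" "U \<inter> \<phi> -` ball (\<phi> p) e"]) auto
qed

text \<open>The submanifold is a countable union of compact subsets of embedded pieces; by Baire's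
  theorem one of them has interior points in the subspace topology.\<close>

lemma immersed_embedded_at_some_point:
  assumes T: "immersed_submanifold k T" and ne: "topspace T \<noteq> {}"
    and lc: "locally_compact_space (top_of_set (topspace T))"
  shows "\<exists>p\<in>topspace T. embedded_at k (topspace T) p"
proof -
  let ?S = "topspace T"
  have "\<exists>C V P. compact C \<and> openin T V \<and> p \<in> V \<and> V \<subseteq> C \<and> C \<subseteq> P \<and> P \<subseteq> ?S \<and> embedded_submanifold k P"
    if "p \<in> ?S" for p
  proof -
    have "\<exists>P. openin T P \<and> p \<in> P \<and> subtopology T P = top_of_set P \<and> embedded_submanifold k P"
      using T that unfolding immersed_submanifold_def by simp
    then obtain P where P: "openin T P" "p \<in> P" "subtopology T P = top_of_set P" "embedded_submanifold k P"
      by blast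
    obtain C N where C: "compact C" "C \<subseteq> P" "open N" "p \<in> N" "P \<inter> N \<subseteq> C"
      using embedded_at_compact_neighbourhood P by (metis embedded_submanifold_iff)
    have "openin (subtopology T P) (P \<inter> N)"
      using C(3) P(3) by (auto simp: openin_open)
    then have "openin T (P \<inter> N)"
      using P(1) by (simp add: openin_open_subtopology)
    then show ?thesis
      using C P openin_subset[OF P(1)] by blast
  qed
  then obtain C V P where CVP: "\<And>p. p \<in> ?S \<Longrightarrow> compact (C p) \<and> openin T (V p) \<and> p \<in> V p \<and> V p \<subseteq> C p \<and>
      C p \<subseteq> P p \<and> P p \<subseteq> ?S \<and> embedded_submanifold k (P p)"
    by metis
  \<comment> \<open>Second countability of T reduces the neighbourhoods V to countably many.\<close>
  have "Lindelof_space T"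
    using T second_countable_imp_Lindelof_space unfolding immersed_submanifold_def by blast
  moreover have "\<Union>(V ` ?S) = ?S"
    using CVP openin_subset by blast
  ultimately obtain \<V> where "countable \<V>" "\<V> \<subseteq> V ` ?S" "\<Union>\<V> = ?S"
    using Lindelof_spaceD[of T "V ` ?S"] CVP by blast
  then obtain I where I: "countable I" "I \<subseteq> ?S" "\<Union>(V ` I) = ?S"
    using countable_subset_image[of \<V> V ?S] by metis
  have sub: "C i \<subseteq> ?S" and V_C: "V i \<subseteq> C i" and compact: "compact (C i)" if "i \<in> I" for i
    using CVP[of i] I(2) that by auto
  have cover: "\<Union>(C ` I) = ?S"
  proof
    show "\<Union>(C ` I) \<subseteq> ?S"
      using sub by blast
    show "?S \<subseteq> \<Union>(C ` I)"
      unfolding I(3)[symmetric] using V_C by blast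
  qed
  have "\<exists>i\<in>I. top_of_set ?S interior_of C i \<noteq> {}"
  proof (rule ccontr)
    assume none: "\<not> ?thesis"
    have "top_of_set ?S interior_of \<Union>(C ` I) = {}"
    proof (rule Baire_category_alt)
      \<comment> \<open>Baire's theorem is used in its version for locally compact regular
        spaces.\<close>
      show "completely_metrizable_space (top_of_set ?S) \<or>
          locally_compact_space (top_of_set ?S) \<and> regular_space (top_of_set ?S)"
        using lc regular_space_subtopology regular_space_euclidean by blast
      show "countable (C ` I)" using I(1) by simp
      fix K assume "K \<in> C ` I"
      then show "closedin (top_of_set ?S) K \<and> top_of_set ?S interior_of K = {}"
        using none sub compact by (auto simp: closed_subset compact_imp_closed)
    qed
    then show False
      using cover ne interior_of_topspace[of "top_of_set ?S"] by (metis topspace_euclidean_subtopology)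
  qed
  then obtain i O1 p where i: "i \<in> I" and O1: "openin (top_of_set ?S) O1" "O1 \<subseteq> C i" "p \<in> O1"
    unfolding interior_of_def by blast
  obtain N where N: "open N" "O1 = ?S \<inter> N"
    using O1(1) by (auto simp: openin_open)
  have P: "C i \<subseteq> P i" "P i \<subseteq> ?S" "embedded_submanifold k (P i)"
    using CVP[of i] i I(2) by auto
  then have "embedded_at k (P i) p"
    using O1 unfolding embedded_submanifold_iff by blast
  \<comment> \<open>An interior point of \<open>C i\<close> is interior to \<open>P i\<close>, so
    near p the whole set coincides with an embedded piece.\<close>
  moreover have "P i \<inter> N = ?S \<inter> N"
    using N O1 P by blast
  ultimately have "embedded_at k ?S p"
    using N O1(3) by (auto intro: embedded_at_local)
  then show ?thesis
    using N O1 by blast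
qed


section \<open>Matrices\<close>

lemma matrix_inv_right: "invertible A \<Longrightarrow> A ** matrix_inv A = mat 1"
  and matrix_inv_left: "invertible A \<Longrightarrow> matrix_inv A ** A = mat 1"
  unfolding invertible_def matrix_inv_def by (metis (mono_tags, lifting) someI_ex)+

lemma matrix_inv_cancel_right: "invertible A \<Longrightarrow> B ** A ** matrix_inv A = B"
  and matrix_inv_cancel_right': "invertible A \<Longrightarrow> B ** matrix_inv A ** A = B"
  and matrix_inv_cancel_left: "invertible A \<Longrightarrow> A ** (matrix_inv A ** C) = C"
  and matrix_inv_cancel_left': "invertible A \<Longrightarrow> matrix_inv A ** (A ** C) = C"
  for A :: "'a::semiring_1^'n^'n"
  by (metis matrix_inv_left matrix_inv_right matrix_mul_assoc matrix_mul_lid matrix_mul_rid)+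

lemma invertible_matrix_inv: "invertible A \<Longrightarrow> invertible (matrix_inv A)"
  unfolding invertible_def[of "matrix_inv A"] using matrix_inv_left matrix_inv_right by blast

lemma matrix_inv_unique:
  fixes A :: "'a::semiring_1^'n^'n"
  assumes "A ** B = mat 1" "B ** A = mat 1"
  shows "matrix_inv A = B"
  using assms matrix_inv_cancel_left'[of A B] unfolding invertible_def by (metis matrix_mul_rid)

lemma invertible_mat_1: "invertible (mat 1 :: 'a::semiring_1^'n^'n)"
  unfolding invertible_def by (intro exI[of _ "mat 1"]) simp

lemma bounded_bilinear_matrix_mult:
  "bounded_bilinear ((**) :: real^'n::finite^'m::finite \<Rightarrow> real^'p::finite^'n \<Rightarrow> real^'p^'m)"
  unfolding bilinear_conv_bounded_bilinear[symmetric] bilinear_def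
  by (auto intro!: linearI simp: matrix_add_ldistrib matrix_scalar_ac scalar_matrix_assoc)
    (vector matrix_matrix_mult_def sum.distrib[symmetric] field_simps)

lemma smooth_on_matrix_mult:
  fixes f :: "'a::euclidean_space \<Rightarrow> real^'n^'m" and g :: "'a \<Rightarrow> real^'p^'n"
  shows "open S \<Longrightarrow> smooth_on S f \<Longrightarrow> smooth_on S g \<Longrightarrow> smooth_on S (\<lambda>x. f x ** g x)"
  by (rule smooth_on_bilinear[OF bounded_bilinear_matrix_mult])

lemma open_invertible_matrices: "open {A :: real^'n^'n. invertible A}"
proof -
  have "open ((\<lambda>A :: real^'n^'n. det A) -` (- {0}))"
    unfolding det_def by (intro open_vimage continuous_intros)
  then show ?thesis
    by (simp add: invertible_det_nz vimage_def)
qed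

text \<open>Left multiplication by A is a family of linear maps depending smoothly on A. Its inverse
  family is left multiplication by \<open>matrix_inv A\<close>, evaluated here at the identity
  matrix.\<close>

lemma smooth_on_matrix_inv: "smooth_on {A. invertible A} (matrix_inv :: real^'n^'n \<Rightarrow> _)"
proof -
  have "smooth_on {A :: real^'n^'n. invertible A} (\<lambda>A. matrix_inv A ** mat 1)"
  proof (rule inverse_family_smooth_on[where A = "(**)" and B = "\<lambda>A. (**) (matrix_inv A)",
        OF open_invertible_matrices])
    show "linear ((**) A)" for A :: "real^'n^'n"
      using bounded_bilinear_matrix_mult
      by (metis bounded_bilinear.bounded_linear_right bounded_linear.linear)
    show "smooth_on {A :: real^'n^'n. invertible A} (\<lambda>A. A ** v)" for v
      by (intro smooth_on_matrix_mult smooth_on_ident smooth_on_const open_invertible_matrices)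
  qed (auto simp: matrix_inv_cancel_left matrix_inv_cancel_left')
  then show ?thesis by simp
qed

lemma smooth_on_matrix_inv_compose:
  fixes f :: "'a::euclidean_space \<Rightarrow> real^'n^'n"
  assumes "open S" "smooth_on S f" "\<And>x. x \<in> S \<Longrightarrow> invertible (f x)"
  shows "smooth_on S (\<lambda>x. matrix_inv (f x))"
  using assms by (intro smooth_on_compose[where f = f and g = matrix_inv, OF _ _ smooth_on_matrix_inv]) auto


section \<open>Jacobians and 1-jets\<close>

lemma has_derivative_jacobian:
  "(f has_derivative D) (at x) \<Longrightarrow> jacobian f (at x) = matrix D"
  unfolding jacobian_def by (metis frechet_derivative_at)

lemma open_diffeo_jacobian:
  fixes \<phi> :: "real^'n \<Rightarrow> real^'n"
  assumes \<phi>: "open_diffeo U \<phi>" and x: "x \<in> U"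
  shows invertible_jacobian: "invertible (jacobian \<phi> (at x))"
    and jacobian_inv_into: "jacobian (inv_into U \<phi>) (at (\<phi> x)) = matrix_inv (jacobian \<phi> (at x))"
proof -
  obtain D D' where D: "(\<phi> has_derivative D) (at x)" "(inv_into U \<phi> has_derivative D') (at (\<phi> x))"
    and inv: "D' \<circ> D = id" "D \<circ> D' = id"
    using open_diffeo_has_derivative_inv_into[OF \<phi> x] .
  have lin: "linear D" "linear D'"
    using D has_derivative_linear by blast+
  have "matrix D' ** matrix D = mat 1" "matrix D ** matrix D' = mat 1"
    using matrix_compose[OF lin] matrix_compose[OF lin(2,1)] inv by (simp_all add: matrix_id_mat_1)
  then show "invertible (jacobian \<phi> (at x))"
      "jacobian (inv_into U \<phi>) (at (\<phi> x)) = matrix_inv (jacobian \<phi> (at x))"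
    using D by (auto simp: has_derivative_jacobian invertible_def matrix_inv_unique)
qed

lemma smooth_on_jacobian:
  fixes f :: "real^'n \<Rightarrow> real^'m"
  assumes "open S" "smooth_on S f"
  shows "smooth_on S (\<lambda>x. jacobian f (at x))"
proof -
  \<comment> \<open>The elementary matrices: the only nonzero entry is a 1 in row i and column
    j.\<close>
  let ?E = "\<lambda>i j. axis i (axis j 1) :: real^'n^'m"
  have "smooth_on S (\<lambda>x. \<Sum>i\<in>UNIV. \<Sum>j\<in>UNIV. (frechet_derivative f (at x) (axis j 1) \<bullet> axis i 1) *\<^sub>R ?E i j)"
    unfolding smooth_on_def using assms
    by (intro allI Ck_on_sum Ck_on_bilinear[OF bounded_bilinear_scaleR] Ck_on_const
        Ck_on_compose_linear[OF bounded_linear_inner_left] smooth_onD[OF smooth_on_frechet_derivative])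
  moreover have "(\<Sum>i\<in>UNIV. \<Sum>j\<in>UNIV. (frechet_derivative f (at x) (axis j 1) \<bullet> axis i 1) *\<^sub>R ?E i j)
      = jacobian f (at x)" (is "(\<Sum>i\<in>UNIV. \<Sum>j\<in>UNIV. ?c i j *\<^sub>R _) = _") for x
  proof -
    have E: "?E i j $ r $ s = (if i = r \<and> j = s then 1 else 0)" for i j r s
      by (auto simp: axis_def)
    have "(\<Sum>i\<in>UNIV. \<Sum>j\<in>UNIV. ?c i j *\<^sub>R ?E i j) $ r $ s = jacobian f (at x) $ r $ s" for r s
    proof -
      have "(\<Sum>i\<in>UNIV. \<Sum>j\<in>UNIV. ?c i j *\<^sub>R ?E i j) $ r $ s =
          (\<Sum>i\<in>UNIV. \<Sum>j\<in>UNIV. ?c i j * ?E i j $ r $ s)"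
        by simp
      also have "\<dots> = (\<Sum>i\<in>UNIV. if i = r then (\<Sum>j\<in>UNIV. if j = s then ?c i j else 0) else 0)"
        unfolding E by (rule sum.cong) (auto intro!: sum.cong simp del: sum.delta sum.delta')
      also have "\<dots> = ?c r s"
        by simp
      also have "\<dots> = jacobian f (at x) $ r $ s"
        by (simp add: jacobian_def matrix_def inner_axis)
      finally show ?thesis .
    qed
    then show ?thesis by (simp add: vec_eq_iff)
  qed
  ultimately show ?thesis by simp
qed

section \<open>Jets as triples\<close>

lemma jet_simps [simp]:
  "src (x, y, A) = x" "tgt (x, y, A) = y" "lin (x, y, A) = A"
  by (simp_all add: src_def tgt_def lin_def)

lemma jet_collapse [simp]: "(src g, tgt g, lin g) = g"
  by (simp add: src_def tgt_def lin_def)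

lemma jet_comp_triple [simp]: "h \<odot> (x, y, A) = (x, tgt h, lin h ** A)"
  by (simp add: jet_comp_def)

lemma has_derivative_transl: "(transl v has_derivative (\<lambda>h. h)) (at x)"
  unfolding transl_def by (auto intro!: derivative_eq_intros)

lemma jacobian_transl: "jacobian (transl v) (at x) = (mat 1 :: real^'n^'n)"
  using has_derivative_jacobian[OF has_derivative_transl, of v x] matrix_id_mat_1
  unfolding id_def by simp

text \<open>An invertible A is realized by an affine map, restricted to the points of M that it
  keeps in M. Questions about jets thereby become questions about matrices.\<close>

lemma mem_jets_iff:
  fixes M :: "(real^'n) set"
  assumes M: "open M"
  shows "(x, y, A) \<in> jets M \<longleftrightarrow> x \<in> M \<and> y \<in> M \<and> invertible A"
proof
  assume "(x, y, A) \<in> jets M"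
  then obtain \<phi> U where "x \<in> U" "U \<subseteq> M" "\<phi> ` U \<subseteq> M" "open_diffeo U \<phi>"
    and "y = \<phi> x" "A = jacobian \<phi> (at x)"
    by (auto simp: jets_def jet1_def local_diffeo_at_def)
  then show "x \<in> M \<and> y \<in> M \<and> invertible A"
    using invertible_jacobian by blast
next
  assume *: "x \<in> M \<and> y \<in> M \<and> invertible A"
  define \<phi> where "\<phi> z = A *v (z - x) + y" for z
  have D: "(\<phi> has_derivative (*v) A) (at z)" for z
    unfolding \<phi>_def
    by (auto intro!: derivative_eq_intros bounded_linear.has_derivative[OF matrix_vector_mul_bounded_linear])
  then have D': "frechet_derivative \<phi> (at z) = (*v) A" for z
    by (metis frechet_derivative_at)
  have inj: "inj ((*v) A)"
    using * inj_matrix_vector_mult by blast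
  have eq: "\<phi> z = A *v z + (y - A *v x)" for z
    by (simp add: \<phi>_def matrix_vector_mult_diff_distrib)
  have "open_diffeo UNIV \<phi>"
  proof (rule open_diffeo_of_inj_derivative)
    have "smooth_on UNIV (\<lambda>z. A *v z + (y - A *v x))"
      by (intro smooth_on_add smooth_on_const smooth_on_bounded_linear) auto
    then show "smooth_on UNIV \<phi>"
      by (simp add: eq[abs_def])
    show "inj \<phi>"
      using inj by (auto simp: eq inj_on_def)
  qed (use D' inj in auto)
  moreover have "continuous_on UNIV \<phi>"
    using smooth_on_imp_continuous_on calculation open_diffeo_smooth_on by blast
  then have "open (\<phi> -` M)"
    using M by (simp add: open_vimage)
  then have "open (M \<inter> \<phi> -` M)"
    using M by blast
  ultimately have "open_diffeo (M \<inter> \<phi> -` M) \<phi>"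
    using open_diffeo_subset by blast
  moreover have "\<phi> x = y"
    by (simp add: \<phi>_def)
  ultimately have "local_diffeo_at M x \<phi>"
    using * unfolding local_diffeo_at_def by (intro exI[of _ "M \<inter> \<phi> -` M"]) auto
  moreover have "jet1 \<phi> x = (x, y, A)"
    using has_derivative_jacobian[OF D] \<open>\<phi> x = y\<close> by (simp add: jet1_def)
  ultimately show "(x, y, A) \<in> jets M"
    unfolding jets_def by force
qed

lemma jets_eq: "open M \<Longrightarrow> jets M = M \<times> M \<times> {A. invertible A}"
  using mem_jets_iff by auto

lemma open_jets: "open M \<Longrightarrow> open (jets M)"
  by (simp add: jets_eq open_Times open_invertible_matrices)

text \<open>Translations have Jacobian 1, so only the Jacobians of the two charts survive.\<close>

lemma trivialization_eq:
  fixes g :: "'n::finite jet"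
  assumes U: "open_diffeo U \<psi>U" "src g \<in> U" and V: "open_diffeo V \<psi>V" "tgt g \<in> V"
  shows "trivialization U \<psi>U \<psi>V g = (\<psi>U (src g), \<psi>V (tgt g),
    jacobian \<psi>V (at (tgt g)) ** lin g ** matrix_inv (jacobian \<psi>U (at (src g))))"
proof -
  obtain D where D: "(\<psi>V has_derivative D) (at (tgt g))"
    using open_diffeo_has_derivative_inv_into[OF V] .
  have "(transl (- \<psi>V (tgt g)) \<circ> \<psi>V has_derivative D) (at (tgt g))"
    using diff_chain_at[OF D has_derivative_transl] by (simp add: o_def)
  then have 1: "jacobian (transl (- \<psi>V (tgt g)) \<circ> \<psi>V) (at (tgt g)) = jacobian \<psi>V (at (tgt g))"
    using D by (simp add: has_derivative_jacobian)
  obtain D' where D': "(inv_into U \<psi>U has_derivative D') (at (\<psi>U (src g)))"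
    using open_diffeo_has_derivative_inv_into[OF U] .
  have "(inv_into U \<psi>U \<circ> transl (\<psi>U (src g)) has_derivative D') (at 0)"
    using diff_chain_at[OF has_derivative_transl, of "inv_into U \<psi>U" D' "\<psi>U (src g)" 0] D'
    by (simp add: o_def transl_def)
  then have 2: "jacobian (inv_into U \<psi>U \<circ> transl (\<psi>U (src g))) (at 0) =
      matrix_inv (jacobian \<psi>U (at (src g)))"
    using D' by (simp add: has_derivative_jacobian flip: jacobian_inv_into[OF U])
  show ?thesis
    unfolding trivialization_def jet1_def jet_comp_def by (simp add: 1 2)
qed

text \<open>The translation carries \<open>\<kappa> X\<close> to \<open>\<kappa> Y\<close>, so the
  inverse chart is differentiated at \<open>\<kappa> Y\<close>.\<close>

lemma jet1_chart_translation:
  fixes \<kappa> :: "real^'n \<Rightarrow> real^'n"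
  assumes \<kappa>: "open_diffeo U \<kappa>" and X: "X \<in> U" and Y: "Y \<in> U"
  shows "jet1 (inv_into U \<kappa> \<circ> transl (\<kappa> Y - \<kappa> X) \<circ> \<kappa>) X =
    (X, Y, matrix_inv (jacobian \<kappa> (at Y)) ** jacobian \<kappa> (at X))"
proof -
  obtain D where D: "(\<kappa> has_derivative D) (at X)"
    using open_diffeo_has_derivative_inv_into[OF \<kappa> X] .
  obtain D' where D': "(inv_into U \<kappa> has_derivative D') (at (\<kappa> Y))"
    using open_diffeo_has_derivative_inv_into[OF \<kappa> Y] .
  have "(transl (\<kappa> Y - \<kappa> X) \<circ> \<kappa> has_derivative D) (at X)"
    using diff_chain_at[OF D has_derivative_transl] by (simp add: o_def)
  then have "(inv_into U \<kappa> \<circ> (transl (\<kappa> Y - \<kappa> X) \<circ> \<kappa>) has_derivative D' \<circ> D) (at X)"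
    by (rule diff_chain_at) (simp add: transl_def D')
  then have "jacobian (inv_into U \<kappa> \<circ> transl (\<kappa> Y - \<kappa> X) \<circ> \<kappa>) (at X) = matrix D' ** matrix D"
    using has_derivative_jacobian matrix_compose D D' has_derivative_linear by (metis comp_assoc)
  then show ?thesis
    using D D' open_diffeo_inj_on[OF \<kappa>] Y
    by (simp add: jet1_def transl_def has_derivative_jacobian flip: jacobian_inv_into[OF \<kappa> Y])
qed


section \<open>Material isomorphisms\<close>

lemma open_diffeo_imp_deformation:
  assumes "open_diffeo B \<kappa>"
  shows "deformation B \<kappa>"
proof -
  have "homeomorphism B (\<kappa> ` B) \<kappa> (inv_into B \<kappa>)"
    using assms by (auto simp: homeomorphism_def open_diffeo_def smooth_on_imp_continuous_on
        inv_into_into f_inv_into_f image_iff)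
  then show ?thesis
    using assms open_diffeo_derivative_bij bij_is_inj
    unfolding deformation_def open_diffeo_def by blast
qed

text \<open>Injective derivatives between spaces of equal dimension are bijective, so a deformation
  is a global chart of B.\<close>

lemma deformation_imp_open_diffeo:
  assumes "open B" "deformation B \<kappa>"
  shows "open_diffeo B \<kappa>"
proof (rule open_diffeo_of_inj_derivative[OF assms(1)])
  show "inj_on \<kappa> B"
    using assms(2) unfolding deformation_def by (metis homeomorphism_apply1 inj_on_inverseI)
qed (use assms(2) in \<open>auto simp: deformation_def\<close>)

lemma response_ext_jet1:
  "response_ext W (jet1 \<kappa> (tgt g) \<odot> g) = W (src g, src g, jacobian \<kappa> (at (tgt g)) ** lin g)"
  by (simp add: response_ext_def jet1_def jet_comp_def jacobian_transl transl_def)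

text \<open>A deformation enters only through its Jacobian at Y, and every invertible C occurs,
  namely for the linear deformation with matrix C. In the resulting condition B only restricts the
  end points, which permits passing to sub-bodies.\<close>

lemma material_isomorphism_iff:
  fixes B :: "(real^'n) set"
  assumes B: "open B"
  shows "material_isomorphism B W (X, Y, A) \<longleftrightarrow> X \<in> B \<and> Y \<in> B \<and> invertible A \<and>
    (\<forall>C. invertible C \<longrightarrow> W (X, X, C ** A) = W (Y, Y, C))"
proof -
  have ext: "response_ext W (jet1 \<kappa> Y \<odot> (X, Y, A)) = W (X, X, jacobian \<kappa> (at Y) ** A)" for \<kappa>
    using response_ext_jet1[of W \<kappa> "(X, Y, A)"] by (simp del: jet_comp_triple)
  have ext': "response_ext W (jet1 \<kappa> Y) = W (Y, Y, jacobian \<kappa> (at Y))" for \<kappa>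
    by (simp add: response_ext_def jet1_def jacobian_transl transl_def)
  have "(\<forall>\<kappa>. deformation B \<kappa> \<longrightarrow> W (X, X, jacobian \<kappa> (at Y) ** A) = W (Y, Y, jacobian \<kappa> (at Y)))
      \<longleftrightarrow> (\<forall>C. invertible C \<longrightarrow> W (X, X, C ** A) = W (Y, Y, C))" (is "?l \<longleftrightarrow> ?r") if "Y \<in> B"
  proof
    assume r: ?r
    show ?l
      using r invertible_jacobian[OF deformation_imp_open_diffeo[OF B]] that by blast
  next
    assume l: ?l
    show ?r
    proof (intro allI impI)
      fix C :: "real^'n^'n" assume C: "invertible C"
      have D: "((*v) C has_derivative (*v) C) (at x)" for x
        by (rule bounded_linear_imp_has_derivative) simp
      have "open_diffeo B ((*v) C)"
      proof (rule open_diffeo_of_inj_derivative[OF B])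
        show "smooth_on B ((*v) C)"
          using B by (intro smooth_on_bounded_linear) auto
        show "inj_on ((*v) C) B"
          using inj_matrix_vector_mult[OF C] by (rule inj_on_subset) simp
        show "inj (frechet_derivative ((*v) C) (at x))" for x
          using inj_matrix_vector_mult[OF C] frechet_derivative_at[OF D] by metis
      qed
      then have "deformation B ((*v) C)"
        by (rule open_diffeo_imp_deformation)
      with l show "W (X, X, C ** A) = W (Y, Y, C)"
        using has_derivative_jacobian[OF D] by fastforce
    qed
  qed
  then show ?thesis
    unfolding material_isomorphism_def
    by (auto simp: mem_jets_iff[OF B] ext ext' simp del: jet_comp_triple)
qed

lemma mem_material_groupoid_iff:
  fixes B :: "(real^'n) set"
  assumes "open B"
  shows "(X, Y, A) \<in> material_groupoid B W \<longleftrightarrow> X \<in> B \<and> Y \<in> B \<and> invertible A \<and>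
    (\<forall>C. invertible C \<longrightarrow> W (X, X, C ** A) = W (Y, Y, C))"
  by (simp add: material_groupoid_def material_isomorphism_iff[OF assms])

text \<open>For each fixed C the criterion is an equation between continuous functions of the jet,
  hence closed; the groupoid is the intersection over all C.\<close>

lemma closedin_material_groupoid:
  fixes B :: "(real^'n) set"
  assumes B: "open B" and W: "continuous_on (jets B) W"
  shows "closedin (top_of_set (jets B)) (material_groupoid B W)"
proof -
  define f where "f C g = W (src g, src g, C ** lin g) - W (tgt g, tgt g, C)" for C and g :: "'n jet"
  have "continuous_on (jets B) (f C)" if "invertible C" for C
  proof -
    have "continuous_on (jets B) (\<lambda>g. (src g, src g, C ** lin g))"
      unfolding src_def lin_def
      by (intro continuous_intros bounded_linear.continuous_on[OF
          bounded_bilinear.bounded_linear_right[OF bounded_bilinear_matrix_mult]])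
    moreover have "continuous_on (jets B) (\<lambda>g. (tgt g, tgt g, C))"
      unfolding tgt_def by (intro continuous_intros)
    ultimately show ?thesis
      unfolding f_def using that
      by (intro continuous_on_diff continuous_on_compose2[OF W])
        (auto simp: jets_eq[OF B] invertible_mult)
  qed
  then have "closedin (top_of_set (jets B)) {g \<in> jets B. f C g = 0}" if "invertible C" for C
    using that continuous_closedin_preimage_constant by blast
  \<comment> \<open>The identity matrix shows that the family being intersected is nonempty.\<close>
  then have "closedin (top_of_set (jets B)) (\<Inter>C\<in>{C. invertible C}. {g \<in> jets B. f C g = 0})"
    by (intro closedin_INT) (auto intro: invertible_mat_1)
  moreover have "(\<Inter>C\<in>{C. invertible C}. {g \<in> jets B. f C g = 0}) = material_groupoid B W"
    using invertible_mat_1[where 'a = real and 'n = 'n]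
    by (auto simp: mem_material_groupoid_iff[OF B] jets_eq[OF B] f_def)
  ultimately show ?thesis by simp
qed

text \<open>A relatively closed subset of an open set of a Euclidean space is locally compact. This
  is what makes Baire's theorem available for \<Omega>.\<close>

lemma locally_compact_material_groupoid:
  fixes B :: "(real^'n) set"
  assumes B: "open B" and W: "continuous_on (jets B) W"
  shows "locally_compact_space (top_of_set (material_groupoid B W))"
proof -
  have "locally_compact_space (top_of_set (jets B))"
    using open_jets[OF B]
    by (intro locally_compact_space_open_subset locally_compact_space_euclidean) auto
  from locally_compact_space_closed_subset[OF this closedin_material_groupoid[OF assms]]
  show ?thesis
    using closedin_subset[OF closedin_material_groupoid[OF assms]]
    by (simp add: subtopology_subtopology Int_absorb1)
qed


section \<open>Integrability implies local homogeneity\<close>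

lemma integrable_imp_locally_homogeneous:
  fixes B :: "(real^'n) set" and W :: "'n jet \<Rightarrow> 'v::real_normed_vector"
  assumes B: "open B" and \<Omega>: "topspace \<Omega> = material_groupoid B W"
    and int: "integrable_groupoid B \<Omega>"
  shows "locally_homogeneous B W"
  unfolding locally_homogeneous_def
proof
  fix X assume X: "X \<in> B"
  obtain G where "\<forall>x\<in>B. \<forall>y\<in>B. \<exists>U V \<psi>U \<psi>V. x \<in> U \<and> U \<subseteq> B \<and> open_diffeo U \<psi>U \<and>
      y \<in> V \<and> V \<subseteq> B \<and> open_diffeo V \<psi>V \<and>
      diffeomorphism (subtopology \<Omega> {g. src g \<in> U \<and> tgt g \<in> V})
        (prod_topology (top_of_set (\<psi>U ` U)) (prod_topology (top_of_set (\<psi>V ` V)) G))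
        (trivialization U \<psi>U \<psi>V)"
    using int unfolding integrable_groupoid_def by blast
  \<comment> \<open>Both charts are taken around the same point X, so that their domains
    overlap.\<close>
  from this[rule_format, OF X X] obtain U V \<psi>U \<psi>V where U: "X \<in> U" "U \<subseteq> B" "open_diffeo U \<psi>U"
    and V: "X \<in> V" "V \<subseteq> B" "open_diffeo V \<psi>V"
    and "diffeomorphism (subtopology \<Omega> {g. src g \<in> U \<and> tgt g \<in> V})
        (prod_topology (top_of_set (\<psi>U ` U)) (prod_topology (top_of_set (\<psi>V ` V)) G))
        (trivialization U \<psi>U \<psi>V)"
    by blast
  then have bij: "bij_betw (trivialization U \<psi>U \<psi>V)
      (material_groupoid B W \<inter> {g. src g \<in> U \<and> tgt g \<in> V}) (\<psi>U ` U \<times> \<psi>V ` V \<times> topspace G)"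
    by (simp add: diffeomorphism_def \<Omega>)
  let ?N = "U \<inter> V" and ?J = "\<lambda>x. jacobian \<psi>V (at x)"
  have N: "open ?N"
    using U V open_diffeo_imp_open by blast
  note \<psi> = open_diffeo_subset[OF V(3) N Int_lower2]
  have "(p, q, matrix_inv (?J q) ** ?J p) \<in> material_groupoid N W"
    if p: "p \<in> ?N" and q: "q \<in> ?N" and "N = ?N" for p q N
  proof -
    \<comment> \<open>The matrix of the unit at p in the trivialization.\<close>
    let ?C = "?J p ** matrix_inv (jacobian \<psi>U (at p))"
    have inv: "invertible (?J q)" "invertible (jacobian \<psi>U (at p))"
      using p q invertible_jacobian U(3) V(3) by blast+
    have "(p, p, mat 1) \<in> material_groupoid B W"
      using p U(2) by (auto simp: mem_material_groupoid_iff[OF B] invertible_mat_1)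
    then have "trivialization U \<psi>U \<psi>V (p, p, mat 1) \<in> \<psi>U ` U \<times> \<psi>V ` V \<times> topspace G"
      using p by (intro bij_betwE[OF bij, rule_format]) auto
    then have "?C \<in> topspace G"
      using p by (simp add: trivialization_eq[OF U(3) _ V(3)])
    \<comment> \<open>The image of the trivialization is a full product, so the target can be moved
      from p to q while the matrix is kept.\<close>
    then have "(\<psi>U p, \<psi>V q, ?C) \<in> \<psi>U ` U \<times> \<psi>V ` V \<times> topspace G"
      using p q by auto
    then have "(\<psi>U p, \<psi>V q, ?C) \<in>
        trivialization U \<psi>U \<psi>V ` (material_groupoid B W \<inter> {g. src g \<in> U \<and> tgt g \<in> V})"
      unfolding bij_betw_imp_surj_on[OF bij] .
    then obtain g where g: "g \<in> material_groupoid B W" "src g \<in> U" "tgt g \<in> V"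
      and "trivialization U \<psi>U \<psi>V g = (\<psi>U p, \<psi>V q, ?C)"
      by (smt (verit) IntE imageE mem_Collect_eq)
    then have *: "\<psi>U (src g) = \<psi>U p" "\<psi>V (tgt g) = \<psi>V q"
      "?J (tgt g) ** lin g ** matrix_inv (jacobian \<psi>U (at (src g))) = ?C"
      by (simp_all add: trivialization_eq[OF U(3) _ V(3)])
    have st: "src g = p" "tgt g = q"
      using * g p q open_diffeo_inj_on[OF U(3)] open_diffeo_inj_on[OF V(3)] by (auto dest: inj_onD)
    have "?J q ** lin g = ?J p"
      using arg_cong[OF *(3), of "\<lambda>M. M ** jacobian \<psi>U (at p)"] inv(2)
      by (simp add: st matrix_inv_cancel_right')
    then have "lin g = matrix_inv (?J q) ** ?J p"
      using matrix_inv_cancel_left'[OF inv(1)] by metis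
    then have "(p, q, matrix_inv (?J q) ** ?J p) \<in> material_groupoid B W"
      using g(1) st jet_collapse[of g] by simp
    \<comment> \<open>The matrix criterion is the same for B and for the sub-body, so the jet is
      material for the latter too.\<close>
    then show ?thesis
      using p q N unfolding \<open>N = ?N\<close>
      by (simp add: mem_material_groupoid_iff[OF B] mem_material_groupoid_iff[OF N])
  qed
  then have "homogeneous ?N W"
    unfolding homogeneous_def
    using open_diffeo_imp_deformation[OF \<psi>] by (auto simp: jet1_chart_translation[OF \<psi>] intro!: exI[of _ \<psi>V])
  then show "\<exists>U. open U \<and> X \<in> U \<and> U \<subseteq> B \<and> homogeneous U W"
    using N U V by blast
qed


section \<open>Homogeneity implies integrability\<close>

lemma second_countable_euclidean: "second_countable (euclidean :: 'a::second_countable_topology topology)"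
proof -
  obtain \<B> :: "'a set set" where "countable \<B>" "topological_basis \<B>"
    using ex_countable_basis by blast
  then show ?thesis
    unfolding second_countable_def open_openin[symmetric]
    by (metis topological_basis_open topological_basisE)
qed

lemma smooth_map_top_of_setI:
  assumes "open N" "S \<subseteq> N" "smooth_on N F" "\<And>x. x \<in> S \<Longrightarrow> f x = F x" "f ` S \<subseteq> T"
  shows "smooth_map (top_of_set S) (top_of_set T) f"
proof -
  have "continuous_on S F"
    using smooth_on_imp_continuous_on[OF assms(3)] assms(2) by (rule continuous_on_subset)
  then have "continuous_on S f"
    using assms(4) by (simp cong: continuous_on_cong)
  then show ?thesis
    unfolding smooth_map_def
  proof (intro conjI ballI)
    show "continuous_map (top_of_set S) (top_of_set T) f"
      using \<open>continuous_on S f\<close> assms(5) by auto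
    show "\<exists>P O' F. openin (top_of_set S) P \<and> p \<in> P \<and> open O' \<and> P \<subseteq> O' \<and> smooth_on O' F \<and> (\<forall>q\<in>P. f q = F q)"
      if "p \<in> topspace (top_of_set S)" for p
      using that assms by (intro exI[of _ S] exI[of _ N] exI[of _ F]) simp
  qed
qed

text \<open>What homogeneity says about the groupoid alone, without the response functional: there
  is a global chart \<kappa> all of whose translations have their jets in \<Omega>.\<close>

locale translation_subgroupoid =
  fixes B :: "(real^'n) set" and \<kappa> :: "real^'n \<Rightarrow> real^'n" and \<Omega> :: "'n jet set"
  assumes open_B: "open B" and \<kappa>: "open_diffeo B \<kappa>" and subgroupoid: "subgroupoid B \<Omega>"
    and translation: "\<lbrakk>x \<in> B; y \<in> B\<rbrakk> \<Longrightarrow>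
      (x, y, matrix_inv (jacobian \<kappa> (at y)) ** jacobian \<kappa> (at x)) \<in> \<Omega>"
begin

abbreviation J :: "real^'n \<Rightarrow> real^'n^'n" where
  "J x \<equiv> jacobian \<kappa> (at x)"

text \<open>The isotropy group read in the chart \<kappa>. Quantifying over all pairs avoids a base
  point; by \<open>mem_iff\<close> a single pair suffices.\<close>

definition G :: "(real^'n^'n) set" where
  "G = {C. invertible C \<and> (\<forall>x\<in>B. \<forall>y\<in>B. (x, y, matrix_inv (J y) ** C ** J x) \<in> \<Omega>)}"

text \<open>The chart that \<kappa> induces on jets. As a map of ambient triples it is a
  diffeomorphism of open sets, and on \<open>jets B\<close> it is the trivialization given by
  \<kappa> at both ends.\<close>

definition \<Theta> :: "'n jet \<Rightarrow> 'n jet" where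
  "\<Theta> g = (\<kappa> (src g), \<kappa> (tgt g), J (tgt g) ** lin g ** matrix_inv (J (src g)))"

definition \<Theta>_inv :: "'n jet \<Rightarrow> 'n jet" where
  "\<Theta>_inv z = (inv_into B \<kappa> (src z), inv_into B \<kappa> (tgt z),
    matrix_inv (J (inv_into B \<kappa> (tgt z))) ** lin z ** J (inv_into B \<kappa> (src z)))"

section \<open>The structure group in the coordinates \<kappa>\<close>

lemma J: "x \<in> B \<Longrightarrow> invertible (J x)"
  using invertible_jacobian[OF \<kappa>] .

lemma comp_mem: "\<lbrakk>(y, z, A) \<in> \<Omega>; (x, y, A') \<in> \<Omega>\<rbrakk> \<Longrightarrow> (x, z, A ** A') \<in> \<Omega>"
  using subgroupoid unfolding subgroupoid_def by force

lemma inverse_mem: "(x, y, A) \<in> \<Omega> \<Longrightarrow> (y, x, matrix_inv A) \<in> \<Omega>"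
  using subgroupoid unfolding subgroupoid_def jet_inverse_def by force

lemma mem_imp: "(x, y, A) \<in> \<Omega> \<Longrightarrow> x \<in> B \<and> y \<in> B \<and> invertible A"
  using subgroupoid unfolding subgroupoid_def mem_jets_iff[OF open_B, symmetric] by blast

lemma G_invertible: "C \<in> G \<Longrightarrow> invertible C"
  by (simp add: G_def)

lemma one_G: "mat 1 \<in> G"
  by (simp add: G_def invertible_mat_1 translation)

lemma mult_G:
  assumes "C \<in> G" "D \<in> G" shows "C ** D \<in> G"
proof -
  have "(x, y, matrix_inv (J y) ** (C ** D) ** J x) \<in> \<Omega>" if "x \<in> B" "y \<in> B" for x y
  proof -
    have "(y, y, matrix_inv (J y) ** C ** J y) \<in> \<Omega>" "(x, y, matrix_inv (J y) ** D ** J x) \<in> \<Omega>"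
      using assms that by (auto simp: G_def)
    from comp_mem[OF this] show ?thesis
      using J[OF that(2)] by (simp add: matrix_mul_assoc matrix_inv_cancel_right)
  qed
  then show ?thesis
    using assms by (auto simp: G_def invertible_mult)
qed

lemma matrix_inv_G:
  assumes "C \<in> G" shows "matrix_inv C \<in> G"
proof -
  have "(x, y, matrix_inv (J y) ** matrix_inv C ** J x) \<in> \<Omega>" if "x \<in> B" "y \<in> B" for x y
  proof -
    have "(y, x, matrix_inv (J x) ** C ** J y) \<in> \<Omega>"
      using assms that by (auto simp: G_def)
    moreover have "matrix_inv (matrix_inv (J x) ** C ** J y) = matrix_inv (J y) ** matrix_inv C ** J x"
    proof (rule matrix_inv_unique)
      show "matrix_inv (J x) ** C ** J y ** (matrix_inv (J y) ** matrix_inv C ** J x) = mat 1"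
        "matrix_inv (J y) ** matrix_inv C ** J x ** (matrix_inv (J x) ** C ** J y) = mat 1"
        using J[OF that(1)] J[OF that(2)] G_invertible[OF assms]
        by (simp_all add: matrix_mul_assoc matrix_inv_cancel_right matrix_inv_cancel_right'
            matrix_inv_left)
    qed
    ultimately show ?thesis
      using inverse_mem by metis
  qed
  then show ?thesis
    using assms by (auto simp: G_def invertible_matrix_inv)
qed

lemma mult_right_G_iff:
  assumes "M \<in> G" shows "C ** M \<in> G \<longleftrightarrow> C \<in> G"
  using mult_G[OF _ matrix_inv_G[OF assms]] mult_G[OF _ assms]
    matrix_inv_cancel_right[OF G_invertible[OF assms]] by metis

text \<open>Composing on both sides with jets of translations moves a jet from the pair (x, y) to
  any other pair without changing its matrix in the coordinates \<kappa>.\<close>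

lemma mem_iff: "(x, y, A) \<in> \<Omega> \<longleftrightarrow> x \<in> B \<and> y \<in> B \<and> J y ** A ** matrix_inv (J x) \<in> G"
proof (safe)
  assume *: "(x, y, A) \<in> \<Omega>"
  then show B: "x \<in> B" "y \<in> B"
    using mem_imp by blast+
  have "(x', y', matrix_inv (J y') ** (J y ** A ** matrix_inv (J x)) ** J x') \<in> \<Omega>"
    if "x' \<in> B" "y' \<in> B" for x' y'
    using comp_mem[OF translation[OF B(2) that(2)] comp_mem[OF * translation[OF that(1) B(1)]]]
    by (simp add: matrix_mul_assoc)
  then show "J y ** A ** matrix_inv (J x) \<in> G"
    using mem_imp[OF *] J B by (auto simp: G_def invertible_mult invertible_matrix_inv)
next
  assume B: "x \<in> B" "y \<in> B" and "J y ** A ** matrix_inv (J x) \<in> G"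
  then have "(x, y, matrix_inv (J y) ** (J y ** A ** matrix_inv (J x)) ** J x) \<in> \<Omega>"
    by (auto simp: G_def)
  then show "(x, y, A) \<in> \<Omega>"
    using J[OF B(1)] J[OF B(2)]
    by (simp add: matrix_inv_cancel_right' matrix_inv_left flip: matrix_mul_assoc)
      (simp add: matrix_mul_assoc matrix_inv_left)
qed

section \<open>The induced chart on jets\<close>

lemma \<kappa>_inv: "x \<in> B \<Longrightarrow> inv_into B \<kappa> (\<kappa> x) = x"
  using open_diffeo_inj_on[OF \<kappa>] by simp

lemma \<Theta>_inv_\<Theta>: "g \<in> jets B \<Longrightarrow> \<Theta>_inv (\<Theta> g) = g"
  by (cases g) (simp add: \<Theta>_def \<Theta>_inv_def mem_jets_iff[OF open_B] \<kappa>_inv matrix_mul_assoc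
      matrix_inv_cancel_right' J matrix_inv_left)

lemma \<Theta>_\<Theta>_inv: "z \<in> \<kappa> ` B \<times> \<kappa> ` B \<times> {C. invertible C} \<Longrightarrow> \<Theta> (\<Theta>_inv z) = z"
  by (cases z) (auto simp: \<Theta>_def \<Theta>_inv_def \<kappa>_inv matrix_mul_assoc
      matrix_inv_cancel_right J matrix_inv_right)

lemma \<Theta>_image_jets: "\<Theta> ` jets B = \<kappa> ` B \<times> \<kappa> ` B \<times> {C. invertible C}"
proof
  show "\<Theta> ` jets B \<subseteq> \<kappa> ` B \<times> \<kappa> ` B \<times> {C. invertible C}"
    by (auto simp: \<Theta>_def jets_eq[OF open_B] J invertible_mult invertible_matrix_inv)
  have "\<Theta>_inv z \<in> jets B" if "z \<in> \<kappa> ` B \<times> \<kappa> ` B \<times> {C. invertible C}" for z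
    using that by (auto simp: \<Theta>_inv_def jets_eq[OF open_B] \<kappa>_inv J invertible_mult invertible_matrix_inv)
  then show "\<kappa> ` B \<times> \<kappa> ` B \<times> {C. invertible C} \<subseteq> \<Theta> ` jets B"
    using \<Theta>_\<Theta>_inv by (metis image_eqI subsetI)
qed

lemma \<Theta>_mem_iff: "g \<in> jets B \<Longrightarrow> \<Theta> g \<in> \<kappa> ` B \<times> \<kappa> ` B \<times> G \<longleftrightarrow> g \<in> \<Omega>"
  by (cases g) (simp add: \<Theta>_def mem_jets_iff[OF open_B] mem_iff)

lemma smooth_on_J: "smooth_on B J"
  using smooth_on_jacobian[OF open_B open_diffeo_smooth_on[OF \<kappa>]] .

lemma smooth_on_\<Theta>: "smooth_on (jets B) \<Theta>"
proof -
  note op = open_jets[OF open_B]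
  have st: "smooth_on (jets B) src" "smooth_on (jets B) tgt" "smooth_on (jets B) lin"
    unfolding src_def tgt_def lin_def
    by (intro smooth_on_fst smooth_on_snd smooth_on_ident op)+
  have sub: "src ` jets B \<subseteq> B" "tgt ` jets B \<subseteq> B"
    by (auto simp: jets_eq[OF open_B])
  note comp = smooth_on_compose[OF op st(1) _ sub(1)] smooth_on_compose[OF op st(2) _ sub(2)]
  show ?thesis
    unfolding \<Theta>_def using sub
    by (intro smooth_on_Pair smooth_on_matrix_mult smooth_on_matrix_inv_compose comp op st
        smooth_on_J open_diffeo_smooth_on[OF \<kappa>] J) auto
qed

lemma smooth_on_\<Theta>_inv: "smooth_on (\<kappa> ` B \<times> \<kappa> ` B \<times> {C. invertible C}) \<Theta>_inv" (is "smooth_on ?D _")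
proof -
  have op: "open ?D"
    using open_diffeo_open_image[OF \<kappa>] by (intro open_Times open_invertible_matrices)
  have st: "smooth_on ?D src" "smooth_on ?D tgt" "smooth_on ?D lin"
    unfolding src_def tgt_def lin_def
    by (intro smooth_on_fst smooth_on_snd smooth_on_ident op)+
  have sub: "src ` ?D \<subseteq> \<kappa> ` B" "tgt ` ?D \<subseteq> \<kappa> ` B"
    by auto
  note comp = smooth_on_compose[OF op st(1) open_diffeo_smooth_on_inv[OF \<kappa>] sub(1)]
    smooth_on_compose[OF op st(2) open_diffeo_smooth_on_inv[OF \<kappa>] sub(2)]
  have sub': "(\<lambda>z. inv_into B \<kappa> (src z)) ` ?D \<subseteq> B" "(\<lambda>z. inv_into B \<kappa> (tgt z)) ` ?D \<subseteq> B"
    by (auto simp: \<kappa>_inv)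
  note comp' = smooth_on_compose[OF op comp(1) smooth_on_J sub'(1)]
    smooth_on_compose[OF op comp(2) smooth_on_J sub'(2)]
  show ?thesis
    unfolding \<Theta>_inv_def
    by (intro smooth_on_Pair smooth_on_matrix_mult smooth_on_matrix_inv_compose comp comp' op st J)
      (auto simp: \<kappa>_inv)
qed

lemma open_diffeo_\<Theta>: "open_diffeo (jets B) \<Theta>"
  using \<Theta>_inv_\<Theta> open_diffeo_open_image[OF \<kappa>]
  by (intro open_diffeoI[OF open_jets[OF open_B] _ smooth_on_\<Theta> smooth_on_\<Theta>_inv \<Theta>_image_jets])
    (auto intro!: open_Times open_invertible_matrices)

section \<open>Embeddedness by homogeneity\<close>

lemma open_diffeo_mult_right:
  fixes M :: "real^'n^'n"
  assumes "invertible M"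
  shows "open_diffeo UNIV (\<lambda>C :: real^'n^'n. C ** M)"
  using assms
  by (intro open_diffeoI[where V = UNIV and g = "\<lambda>C. C ** matrix_inv M"]
      smooth_on_matrix_mult smooth_on_ident smooth_on_const)
    (auto simp: matrix_inv_cancel_right image_iff intro!: exI[of _ "_ ** matrix_inv M"]
      matrix_inv_cancel_right'[symmetric])

text \<open>Translations in the two base factors and right multiplication by elements of G preserve
  the product locally and act transitively on it, so embeddedness at one point spreads to every
  other.\<close>

lemma embedded_at_product_translate:
  assumes emb: "embedded_at k (\<kappa> ` B \<times> \<kappa> ` B \<times> G) (u, v, C)" and C: "C \<in> G"
    and z: "u' \<in> \<kappa> ` B" "v' \<in> \<kappa> ` B" "C' \<in> G" and uv: "u \<in> \<kappa> ` B" "v \<in> \<kappa> ` B"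
  shows "embedded_at k (\<kappa> ` B \<times> \<kappa> ` B \<times> G) (u', v', C')"
proof -
  \<comment> \<open>Chosen so that \<open>?\<Psi>\<close> maps \<open>(u', v', C')\<close> to
    \<open>(u, v, C)\<close>.\<close>
  let ?M = "matrix_inv C' ** C" and ?a = "u - u'" and ?b = "v - v'"
  let ?\<Psi> = "\<lambda>z. (fst z + ?a, fst (snd z) + ?b, snd (snd z) ** ?M)"
  \<comment> \<open>The points of the image of \<kappa> that stay in it under translation by a; on
    them the translation preserves membership.\<close>
  let ?D = "\<lambda>a. \<kappa> ` B \<inter> (\<lambda>u. u + a) -` (\<kappa> ` B)"
  let ?N = "?D ?a \<times> ?D ?b \<times> (UNIV :: (real^'n^'n) set)"
  have M: "?M \<in> G"
    using mult_G matrix_inv_G z C by blast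
  have inv: "invertible ?M" "invertible C'"
    using M z by (auto intro: G_invertible)
  have "open (?D a)" for a
    using open_diffeo_open_image[OF \<kappa>] by (intro open_Int open_vimage continuous_intros)
  then have N: "open ?N"
    by (intro open_Times) auto
  have "open_diffeo UNIV ?\<Psi>"
  proof (rule open_diffeoI[where V = UNIV and
        g = "\<lambda>z. (fst z + - ?a, fst (snd z) + - ?b, snd (snd z) ** matrix_inv ?M)"])
    show "range ?\<Psi> = UNIV"
    proof (intro surjI)
      show "?\<Psi> ((\<lambda>z. (fst z + - ?a, fst (snd z) + - ?b, snd (snd z) ** matrix_inv ?M)) z) = z" for z
        using inv(1) by (simp add: matrix_inv_cancel_right')
    qed
  qed (use inv(1) in \<open>auto simp: matrix_inv_cancel_right simp del: add_uminus_conv_diff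
      intro!: smooth_on_Pair smooth_on_add smooth_on_const
      smooth_on_matrix_mult smooth_on_fst smooth_on_snd smooth_on_ident\<close>)
  then have \<Psi>: "open_diffeo ?N ?\<Psi>"
    using N by (rule open_diffeo_subset) auto
  show ?thesis
  proof (rule embedded_at_diffeo[OF \<Psi>])
    show "(u', v', C') \<in> ?N"
      using z uv by auto
    have "?\<Psi> (u', v', C') = (u, v, C)"
      using inv by (simp add: matrix_inv_cancel_left)
    then show "embedded_at k (\<kappa> ` B \<times> \<kappa> ` B \<times> G) (?\<Psi> (u', v', C'))"
      using emb by simp
    show "z \<in> \<kappa> ` B \<times> \<kappa> ` B \<times> G \<longleftrightarrow> ?\<Psi> z \<in> \<kappa> ` B \<times> \<kappa> ` B \<times> G" if "z \<in> ?N" for z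
      using that by (auto simp: mult_right_G_iff[OF M])
  qed
qed

text \<open>The inverse of \<Theta> carries embeddedness of \<Omega> at g to the product at
  \<open>\<Theta> g\<close>, and homogeneity of the product does the rest.\<close>

lemma embedded_product:
  assumes "g \<in> \<Omega>" "embedded_at k \<Omega> g"
  shows "embedded_submanifold k (\<kappa> ` B \<times> \<kappa> ` B \<times> G)"
proof -
  have g: "g \<in> jets B"
    using subgroupoid assms(1) unfolding subgroupoid_def by blast
  have \<Theta>g: "\<Theta> g \<in> \<Theta> ` jets B"
    using g by blast
  have inv: "inv_into (jets B) \<Theta> (\<Theta> h) = h" if "h \<in> jets B" for h
    using that open_diffeo_inj_on[OF open_diffeo_\<Theta>] by simp
  have "embedded_at k (\<kappa> ` B \<times> \<kappa> ` B \<times> G) (\<Theta> g)"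
  proof (rule embedded_at_diffeo[OF open_diffeo_inv_into[OF open_diffeo_\<Theta>] \<Theta>g])
    show "embedded_at k \<Omega> (inv_into (jets B) \<Theta> (\<Theta> g))"
      using assms(2) inv[OF g] by simp
    show "z \<in> \<kappa> ` B \<times> \<kappa> ` B \<times> G \<longleftrightarrow> inv_into (jets B) \<Theta> z \<in> \<Omega>" if z: "z \<in> \<Theta> ` jets B" for z
    proof -
      obtain h where "h \<in> jets B" "z = \<Theta> h"
        using z by blast
      then show ?thesis
        using inv \<Theta>_mem_iff by simp
    qed
  qed
  moreover obtain u v C where uvC: "\<Theta> g = (u, v, C)"
    by (metis prod_cases3)
  ultimately have emb: "embedded_at k (\<kappa> ` B \<times> \<kappa> ` B \<times> G) (u, v, C)"
    by simp
  have "u \<in> \<kappa> ` B" "v \<in> \<kappa> ` B" "C \<in> G"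
    using \<Theta>_mem_iff[OF g] assms(1) uvC by auto
  then show ?thesis
    unfolding embedded_submanifold_iff
    using embedded_at_product_translate[OF emb] by (metis SigmaE)
qed

lemma embedded_\<Omega>:
  assumes "embedded_submanifold k (\<kappa> ` B \<times> \<kappa> ` B \<times> G)"
  shows "embedded_submanifold k \<Omega>"
  unfolding embedded_submanifold_iff
proof
  fix g assume "g \<in> \<Omega>"
  then have g: "g \<in> jets B"
    using subgroupoid unfolding subgroupoid_def by blast
  show "embedded_at k \<Omega> g"
  proof (rule embedded_at_diffeo[OF open_diffeo_\<Theta> g])
    show "embedded_at k (\<kappa> ` B \<times> \<kappa> ` B \<times> G) (\<Theta> g)"
      using assms[unfolded embedded_submanifold_iff, rule_format] \<open>g \<in> \<Omega>\<close> \<Theta>_mem_iff[OF g]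
      by simp
    show "h \<in> \<Omega> \<longleftrightarrow> \<Theta> h \<in> \<kappa> ` B \<times> \<kappa> ` B \<times> G" if "h \<in> jets B" for h
      using \<Theta>_mem_iff[OF that] by (rule sym)
  qed
qed

text \<open>Splitting off the open base factors one after the other gives a slice chart of G at the
  identity, which right multiplications carry to all of G.\<close>

lemma embedded_G:
  assumes emb: "embedded_submanifold k (\<kappa> ` B \<times> \<kappa> ` B \<times> G)" and "B \<noteq> {}"
  shows "\<exists>j. embedded_submanifold j G"
proof -
  obtain u where u: "u \<in> \<kappa> ` B"
    using \<open>B \<noteq> {}\<close> by blast
  note op = open_diffeo_open_image[OF \<kappa>]
  have u1: "(u, mat 1) \<in> \<kappa> ` B \<times> G"
    using u one_G by simp
  have "embedded_at k (\<kappa> ` B \<times> \<kappa> ` B \<times> G) (u, u, mat 1)"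
    by (rule emb[unfolded embedded_submanifold_iff, rule_format]) (use u u1 in simp)
  from embedded_at_factor[OF this op u u1]
  obtain i where "embedded_at i (\<kappa> ` B \<times> G) (u, mat 1)"
    by blast
  from embedded_at_factor[OF this op u one_G] obtain j where j: "embedded_at j G (mat 1)"
    by blast
  have "embedded_at j G C" if "C \<in> G" for C
  proof (rule embedded_at_diffeo)
    show "open_diffeo UNIV (\<lambda>D :: real^'n^'n. D ** matrix_inv C)"
      using that by (intro open_diffeo_mult_right invertible_matrix_inv G_invertible)
    show "embedded_at j G (C ** matrix_inv C)"
      using j by (simp add: matrix_inv_right[OF G_invertible[OF that]])
  qed (use mult_right_G_iff[OF matrix_inv_G[OF that]] in auto)
  then show ?thesis
    unfolding embedded_submanifold_iff by blast
qed

section \<open>The Lie subgroup and the global trivialization\<close>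

lemma lie_subgroup_G:
  assumes "embedded_submanifold j G"
  shows "lie_subgroup_GL (top_of_set G)"
proof -
  have "immersed_submanifold j (top_of_set G)"
    unfolding immersed_submanifold_def
    using assms by (auto simp: second_countable_subtopology second_countable_euclidean subtopology_subtopology intro!: exI[of _ G])
  moreover have "smooth_map (top_of_set (G \<times> G)) (top_of_set G) (\<lambda>(A, B). A ** B)"
    by (rule smooth_map_top_of_setI[where N = UNIV and F = "\<lambda>x. fst x ** snd x"])
      (auto intro!: smooth_on_matrix_mult smooth_on_fst smooth_on_snd smooth_on_ident mult_G)
  moreover have "smooth_map (top_of_set G) (top_of_set G) matrix_inv"
    by (rule smooth_map_top_of_setI[OF open_invertible_matrices _ smooth_on_matrix_inv])
      (auto intro: G_invertible matrix_inv_G)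
  ultimately show ?thesis
    unfolding lie_subgroup_GL_def using G_invertible one_G by auto
qed

lemma trivialization_eq_\<Theta>: "g \<in> jets B \<Longrightarrow> trivialization B \<kappa> \<kappa> g = \<Theta> g"
  by (auto simp: trivialization_eq[OF \<kappa> _ \<kappa>] \<Theta>_def jets_eq[OF open_B])

text \<open>With subspace topologies on both sides, smoothness comes from the ambient maps
  \<open>\<Theta>\<close> and \<open>\<Theta>_inv\<close>, of which the trivialization and its
  inverse are restrictions.\<close>

lemma diffeomorphism_trivialization:
  "diffeomorphism (top_of_set \<Omega>) (top_of_set (\<kappa> ` B \<times> \<kappa> ` B \<times> G)) (trivialization B \<kappa> \<kappa>)"
proof -
  have sub: "\<Omega> \<subseteq> jets B"
    using subgroupoid unfolding subgroupoid_def by blast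
  let ?t = "trivialization B \<kappa> \<kappa>" and ?P = "\<kappa> ` B \<times> \<kappa> ` B \<times> G"
  let ?D = "\<kappa> ` B \<times> \<kappa> ` B \<times> {C :: real^'n^'n. invertible C}"
  have t: "?t g = \<Theta> g" if "g \<in> \<Omega>" for g
    using sub that trivialization_eq_\<Theta> by blast
  have inj: "inj_on ?t \<Omega>"
  proof (rule inj_on_inverseI)
    show "\<Theta>_inv (?t g) = g" if "g \<in> \<Omega>" for g
      using t[OF that] \<Theta>_inv_\<Theta>[OF subsetD[OF sub that]] by simp
  qed
  have P_D: "?P \<subseteq> ?D"
    using G_invertible by auto
  have im: "?t ` \<Omega> = ?P"
  proof
    show "?t ` \<Omega> \<subseteq> ?P"
    proof (rule image_subsetI)
      fix g assume "g \<in> \<Omega>"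
      then show "?t g \<in> ?P"
        unfolding t[OF \<open>g \<in> \<Omega>\<close>] using \<Theta>_mem_iff[of g] sub by blast
    qed
    show "?P \<subseteq> ?t ` \<Omega>"
    proof
      fix z assume z: "z \<in> ?P"
      then obtain g where "g \<in> jets B" "z = \<Theta> g"
        using P_D \<Theta>_image_jets by blast
      then show "z \<in> ?t ` \<Omega>"
        using z \<Theta>_mem_iff[of g] t[of g] by (metis image_eqI)
    qed
  qed
  have inv: "inv_into \<Omega> ?t z = \<Theta>_inv z" if z: "z \<in> ?P" for z
  proof -
    obtain g where g: "g \<in> \<Omega>" "z = ?t g"
      using z im by blast
    have "inv_into \<Omega> ?t z = g"
      unfolding g(2) using inj g(1) by (rule inv_into_f_f)
    also have "\<dots> = \<Theta>_inv z"
      using g t \<Theta>_inv_\<Theta>[OF subsetD[OF sub g(1)]] by simp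
    finally show ?thesis .
  qed
  have "smooth_map (top_of_set \<Omega>) (top_of_set ?P) ?t"
    using im by (intro smooth_map_top_of_setI[OF open_jets[OF open_B] sub smooth_on_\<Theta> t]) auto
  moreover have "smooth_map (top_of_set ?P) (top_of_set \<Omega>) (inv_into \<Omega> ?t)"
  proof (rule smooth_map_top_of_setI[OF _ P_D smooth_on_\<Theta>_inv inv])
    show "open ?D"
      using open_diffeo_open_image[OF \<kappa>] by (intro open_Times open_invertible_matrices)
    show "inv_into \<Omega> ?t ` ?P \<subseteq> \<Omega>"
      using im inv_into_into by (metis image_subsetI)
  qed
  ultimately show ?thesis
    using inj im by (simp add: diffeomorphism_def bij_betw_def)
qed

lemma integrable:
  assumes \<Omega>: "topspace T = \<Omega>" and lie: "reduced_subgroupoid B T"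
    and lc: "locally_compact_space (top_of_set \<Omega>)"
  shows "integrable_groupoid B T"
proof (cases "B = {}")
  \<comment> \<open>Without points the argument cannot start, but then G is the open set of all
    invertible matrices and the chart condition is vacuous.\<close>
  case True
  then have "G = {C. invertible C}"
    unfolding G_def by simp
  then have "lie_subgroup_GL (top_of_set G)"
    using lie_subgroup_G[OF embedded_submanifold_open] open_invertible_matrices by metis
  then show ?thesis
    using True lie unfolding integrable_groupoid_def by blast
next
  case False
  obtain k where k: "immersed_submanifold k T"
    using lie unfolding reduced_subgroupoid_def lie_subgroupoid_def by blast
  have "topspace T \<noteq> {}"
    using False translation \<Omega> by blast
  then obtain g where "g \<in> \<Omega>" "embedded_at k \<Omega> g"
    using immersed_embedded_at_some_point[OF k] lc \<Omega> by auto
  then have emb: "embedded_submanifold k (\<kappa> ` B \<times> \<kappa> ` B \<times> G)"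
    by (rule embedded_product)
  \<comment> \<open>Embeddedness at one point has spread over all of \<Omega>, so the given topology
    has to be the subspace topology.\<close>
  have T: "T = top_of_set \<Omega>"
    using immersed_topology_eq[OF k] embedded_\<Omega>[OF emb] \<Omega> by simp
  have "lie_subgroup_GL (top_of_set G)"
    using embedded_G[OF emb False] lie_subgroup_G by blast
  \<comment> \<open>The single chart \<kappa> on all of B serves for every pair of points.\<close>
  moreover have "\<Omega> \<inter> {g. src g \<in> B \<and> tgt g \<in> B} = \<Omega>"
    using mem_imp by auto
  then have "diffeomorphism (subtopology T {g. src g \<in> B \<and> tgt g \<in> B})
      (prod_topology (top_of_set (\<kappa> ` B)) (prod_topology (top_of_set (\<kappa> ` B)) (top_of_set G)))
      (trivialization B \<kappa> \<kappa>)"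
    using diffeomorphism_trivialization by (simp add: T subtopology_subtopology)
  ultimately show ?thesis
    unfolding integrable_groupoid_def using lie \<kappa> by blast
qed

end

theorem proposition5p1:
  fixes B :: "(real^3) set"
    and W :: "3 jet \<Rightarrow> 'v::real_normed_vector"
    and \<Omega> :: "3 jet topology"
  assumes "body B W"
    and "uniform B W"
    and "topspace \<Omega> = material_groupoid B W"
    and "lie_subgroupoid B \<Omega>"
  shows "(homogeneous B W \<longrightarrow> integrable_groupoid B \<Omega>) \<and>
         (integrable_groupoid B \<Omega> \<longrightarrow> locally_homogeneous B W)"
proof (intro conjI impI)
  have B: "open B" and W: "continuous_on (jets B) W"
    using assms(1) by (auto simp: body_def differentiable_imp_continuous_on)
  show "locally_homogeneous B W" if "integrable_groupoid B \<Omega>"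
    using integrable_imp_locally_homogeneous[OF B assms(3) that] .
  assume "homogeneous B W"
  then obtain \<kappa> where "deformation B \<kappa>" and P: "\<And>X Y. X \<in> B \<Longrightarrow> Y \<in> B \<Longrightarrow>
      jet1 (inv_into B \<kappa> \<circ> transl (\<kappa> Y - \<kappa> X) \<circ> \<kappa>) X \<in> material_groupoid B W"
    unfolding homogeneous_def by blast
  then have \<kappa>: "open_diffeo B \<kappa>"
    using B by (intro deformation_imp_open_diffeo)
  \<comment> \<open>Homogeneity with respect to \<kappa> is the locale assumption on translations,
    once their jets are written out as triples.\<close>
  interpret translation_subgroupoid B \<kappa> "topspace \<Omega>"
    using B \<kappa> P assms(3,4) by unfold_locales (auto simp: lie_subgroupoid_def jet1_chart_translation)
  \<comment> \<open>Uniformity is transitivity of the material groupoid.\<close>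
  have "reduced_subgroupoid B \<Omega>"
    using assms(2-4) unfolding reduced_subgroupoid_def uniform_def material_groupoid_def by blast
  then show "integrable_groupoid B \<Omega>"
    using locally_compact_material_groupoid[OF B W] assms(3) by (intro integrable) auto
qed

end
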